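(* Let $a>0$ and let $X_a=(M,g_a,J_a)$ be the almost Kähler structure on the Kodaira–Thurston manifold $M$ specified in the context. Then the Ricci curvature $\mathrm{Ric}(\nabla^c)$ of the canonical connection $\nabla^c$ of $X_a$ vanishes identically. In particular, the scalar curvature $\mathrm{scal}(\nabla^c)$ also vanishes.
   Context: **Manifold.** $M=S^1\times G$, where $G$ is the left quotient of the real Heisenberg group of matrices $\begin{pmatrix}1&x&z\\0&1&y\\0&0&1\end{pmatrix}$ by its subgroup of integer matrices, and $t$ is the coordinate on $S^1$. Global frame: $e_1=\partial_t$, $e_2=\partial_x$, $e_3=\partial_y+x\,\partial_z$, $e_4=\partial_z$, with dual coframe $e^1=dt$, $e^2=dx$, $e^3=dy$, $e^4=dz-x\,dy$. The only nontrivial bracket is $[e_2,e_3]=e_4$. **Structures.** $J_ae_1=e_2$, $J_ae_2=-e_1$, $J_ae_3=\frac1a e_4$, $J_ae_4=-a\,e_3$; $\omega=e^1\wedge e^2+e^3\wedge e^4$; $g_a(\cdot,\cdot)=\omega(\cdot,J_a\cdot)$, a Riemannian metric for $a>0$. **Canonical connection.** For an almost Kähler manifold $(M,g,J)$ with Levi-Civita connection $\nabla^{LC}$, the canonical connection is $\nabla^c_XY=\frac12\left(\nabla^{LC}_XY-J\nabla^{LC}_X(JY)\right)$ on $TM$; it satisfies $\nabla^cg=0$, $\nabla^cJ=0$, and is extended complex-linearly, so that it restricts to a connection on $T^{1,0}M$. **Ricci and scalar curvature.** Let $\{z_1,\dots,z_n\}$ be a local frame of $T^{1,0}M$ unitary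 for $h(Z,W)=g_{\mathbb{C}}(Z,\bar W)$ ($g_{\mathbb C}$ the complex bilinear extension of $g$), with dual coframe $\{z^1,\dots,z^n\}$. The connection forms are defined by $\nabla^cz_j=\sum_i\theta^i_j\otimes z_i$, and the curvature forms by $\Psi^i_j=d\theta^i_j+\sum_k\theta^i_k\wedge\theta^k_j$. Write the $(1,1)$-part as $(\Psi^i_j)^{1,1}=\sum_{k,l}R^i_{jk\bar l}\,z^k\wedge\bar z^l$. Then $\mathrm{Ric}(\nabla^c)=\sum_{k,l}R_{k\bar l}\,z^k\wedge\bar z^l$ with $R_{k\bar l}=\sum_iR^i_{ik\bar l}$, and $\mathrm{scal}(\nabla^c)=\sum_kR_{k\bar k}$. *)

theory Defs
  imports "HOL-Analysis.Analysis"
begin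

section \<open>Smooth maps on open subsets of \<open>\<real>\<^sup>4\<close>\<close>

text \<open>\<open>Ck_on n S f\<close>: \<open>f\<close> is \<open>n\<close> times continuously differentiable on the (open) set \<open>S\<close>.\<close>

fun Ck_on :: "nat \<Rightarrow> (real^4) set \<Rightarrow> (real^4 \<Rightarrow> 'b::real_normed_vector) \<Rightarrow> bool" where
  "Ck_on 0 S f \<longleftrightarrow> continuous_on S f"
| "Ck_on (Suc n) S f \<longleftrightarrow>
     (\<forall>q\<in>S. f differentiable (at q)) \<and>
     (\<forall>i. Ck_on n S (\<lambda>q. frechet_derivative f (at q) (axis i 1)))"

definition smooth_on :: "(real^4) set \<Rightarrow> (real^4 \<Rightarrow> 'b::real_normed_vector) \<Rightarrow> bool" where
  "smooth_on S f \<longleftrightarrow> (\<forall>n. Ck_on n S f)"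


section \<open>The Kodaira--Thurston manifold\<close>

lemma vector_4 [simp]:
  "(vector [x, y, z, w] :: 'a::zero^4) $ 1 = x"
  "(vector [x, y, z, w] :: 'a::zero^4) $ 2 = y"
  "(vector [x, y, z, w] :: 'a::zero^4) $ 3 = z"
  "(vector [x, y, z, w] :: 'a::zero^4) $ 4 = w"
  unfolding vector_def by simp_all

definition heis :: "real \<Rightarrow> real \<Rightarrow> real \<Rightarrow> real^3^3" where
  "heis x y z = vector [vector [1, x, z], vector [0, 1, y], vector [0, 0, 1]]"

definition heis_int :: "(real^3^3) set" where
  "heis_int = {heis (of_int m) (of_int n) (of_int r) | m n r. True}"

text \<open>A point of the left quotient \<open>G\<close> of the Heisenberg group is an orbit of left
  multiplication by integer matrices.\<close>

definition heis_orbit :: "real^3^3 \<Rightarrow> (real^3^3) set" where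
  "heis_orbit A = {N ** A | N. N \<in> heis_int}"

type_synonym kt_point = "complex \<times> (real^3^3) set"

definition KT :: "kt_point set" where
  "KT = sphere 0 1 \<times> {heis_orbit (heis x y z) | x y z. True}"

text \<open>The universal covering \<open>\<real>\<^sup>4 \<rightarrow> M\<close>; \<open>(t, x, y, z) = (q $ 1, q $ 2, q $ 3, q $ 4)\<close> are the
  coordinates, \<open>t\<close> being the angle on the unit circle. \<open>M\<close> carries the quotient topology and
  the smooth structure for which this map is a local diffeomorphism.\<close>

definition kt_proj :: "real^4 \<Rightarrow> kt_point" where
  "kt_proj q = (cis (q $ 1), heis_orbit (heis (q $ 2) (q $ 3) (q $ 4)))"

abbreviation lift :: "kt_point set \<Rightarrow> (real^4) set" where
  "lift U \<equiv> kt_proj -` U"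

definition kt_open :: "kt_point set \<Rightarrow> bool" where
  "kt_open U \<longleftrightarrow> U \<subseteq> KT \<and> open (lift U)"

definition kt_smooth :: "kt_point set \<Rightarrow> (kt_point \<Rightarrow> real) \<Rightarrow> bool" where
  "kt_smooth U f \<longleftrightarrow> smooth_on (lift U) (f \<circ> kt_proj)"

text \<open>The deck transformations of the covering: translation of \<open>t\<close> by periods, and left
  multiplication by integer Heisenberg matrices (see \<open>kt_proj_eq_iff\<close> below).\<close>

definition deck_map :: "int \<Rightarrow> int \<Rightarrow> int \<Rightarrow> int \<Rightarrow> real^4 \<Rightarrow> real^4" where
  "deck_map k m n r q = vector
     [q $ 1 + 2 * pi * of_int k, q $ 2 + of_int m, q $ 3 + of_int n, q $ 4 + of_int m * q $ 3 + of_int r]"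

definition deck :: "(real^4 \<Rightarrow> real^4) set" where
  "deck = {deck_map k m n r | k m n r. True}"

lemma heis_mult: "heis a b c ** heis x y z = heis (a + x) (b + y) (z + a * y + c)"
  by (simp add: heis_def vec_eq_iff forall_3 matrix_matrix_mult_def sum_3)

lemma heis_eq_iff: "heis a b c = heis x y z \<longleftrightarrow> a = x \<and> b = y \<and> c = z"
  by (auto simp: heis_def vec_eq_iff forall_3)

lemma heis_orbit_eq_iff:
  "heis_orbit (heis x y z) = heis_orbit (heis x' y' z') \<longleftrightarrow>
     (\<exists>m n r. heis x' y' z' = heis (of_int m) (of_int n) (of_int r) ** heis x y z)"
    (is "?L \<longleftrightarrow> ?R")
proof
  assume L: ?L
  have "heis x' y' z' = heis (of_int 0) (of_int 0) (of_int 0) ** heis x' y' z'"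
    by (simp add: heis_mult)
  hence "heis x' y' z' \<in> heis_orbit (heis x' y' z')"
    unfolding heis_orbit_def heis_int_def by blast
  hence "heis x' y' z' \<in> heis_orbit (heis x y z)" using L by simp
  thus ?R unfolding heis_orbit_def heis_int_def by blast
next
  assume ?R
  then obtain m n r where e: "heis x' y' z' = heis (of_int m) (of_int n) (of_int r) ** heis x y z"
    by blast
  show ?L
  proof
    show "heis_orbit (heis x' y' z') \<subseteq> heis_orbit (heis x y z)"
    proof
      fix B assume "B \<in> heis_orbit (heis x' y' z')"
      then obtain i j k where "B = heis (of_int i) (of_int j) (of_int k) ** heis x' y' z'"
        unfolding heis_orbit_def heis_int_def by blast
      hence "B = heis (of_int (i + m)) (of_int (j + n)) (of_int (r + i * n + k)) ** heis x y z"
        by (simp add: e heis_mult algebra_simps)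
      thus "B \<in> heis_orbit (heis x y z)" unfolding heis_orbit_def heis_int_def by blast
    qed
    show "heis_orbit (heis x y z) \<subseteq> heis_orbit (heis x' y' z')"
    proof
      fix B assume "B \<in> heis_orbit (heis x y z)"
      then obtain i j k where "B = heis (of_int i) (of_int j) (of_int k) ** heis x y z"
        unfolding heis_orbit_def heis_int_def by blast
      hence "B = heis (of_int (i - m)) (of_int (j - n)) (of_int (k - r - (i - m) * n))
                   ** heis x' y' z'"
        by (simp add: e heis_mult algebra_simps)
      thus "B \<in> heis_orbit (heis x' y' z')" unfolding heis_orbit_def heis_int_def by blast
    qed
  qed
qed

lemma kt_proj_eq_iff: "kt_proj q = kt_proj q' \<longleftrightarrow> (\<exists>\<gamma>\<in>deck. q' = \<gamma> q)"
proof -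
  have "cis (q $ 1) = cis (q' $ 1) \<longleftrightarrow> (\<exists>k::int. q' $ 1 = q $ 1 + 2 * pi * of_int k)"
    unfolding complex_eq_iff cis.sel sin_cos_eq_iff[symmetric]
    using sin_cos_eq_iff[of "q' $ 1" "q $ 1"] by (auto simp: mult_ac)
  moreover have "(\<exists>\<gamma>\<in>deck. q' = \<gamma> q) \<longleftrightarrow> (\<exists>k m n r. q' = deck_map k m n r q)"
    unfolding deck_def by blast
  ultimately show ?thesis
    unfolding kt_proj_def prod.inject heis_orbit_eq_iff heis_mult heis_eq_iff
    by (auto simp: deck_map_def vec_eq_iff forall_4 algebra_simps)
qed

lemma range_kt_proj: "range kt_proj = KT"
proof
  show "range kt_proj \<subseteq> KT" by (auto simp: kt_proj_def KT_def)
  show "KT \<subseteq> range kt_proj"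
  proof
    fix p assume "p \<in> KT"
    then obtain u x y z where p: "p = (u, heis_orbit (heis x y z))" "norm u = 1"
      by (auto simp: KT_def)
    hence "p = kt_proj (vector [Arg u, x, y, z])"
      using cis_Arg[of u] norm_zero[where 'a=complex] by (force simp: kt_proj_def sgn_div_norm)
    thus "p \<in> range kt_proj" by blast
  qed
qed


section \<open>Vector fields and forms\<close>

text \<open>A vector field or form on an open set \<open>U\<close> of \<open>M\<close> is represented by its pull-back along the
  covering, in the coordinate basis: a smooth field on \<open>lift U\<close> invariant under the (differentials
  of the) deck transformations. Complex vector fields are sections of the complexified tangent
  bundle; all complexifications below are componentwise.\<close>

definition vfield :: "kt_point set \<Rightarrow> (real^4 \<Rightarrow> real^4) \<Rightarrow> bool" where
  "vfield U X \<longleftrightarrow> smooth_on (lift U) X \<and>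
     (\<forall>\<gamma>\<in>deck. \<forall>q\<in>lift U. X (\<gamma> q) = frechet_derivative \<gamma> (at q) (X q))"

definition Re_vec :: "complex^4 \<Rightarrow> real^4" where "Re_vec v = (\<chi> i. Re (v $ i))"
definition Im_vec :: "complex^4 \<Rightarrow> real^4" where "Im_vec v = (\<chi> i. Im (v $ i))"
definition cnj_vec :: "complex^4 \<Rightarrow> complex^4" where "cnj_vec v = (\<chi> i. cnj (v $ i))"
definition cplx_vec :: "real^4 \<Rightarrow> real^4 \<Rightarrow> complex^4" where
  "cplx_vec u v = (\<chi> i. Complex (u $ i) (v $ i))"

definition cvfield :: "kt_point set \<Rightarrow> (real^4 \<Rightarrow> complex^4) \<Rightarrow> bool" where
  "cvfield U Z \<longleftrightarrow> vfield U (Re_vec \<circ> Z) \<and> vfield U (Im_vec \<circ> Z)"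

definition cplx_endo :: "(real^4 \<Rightarrow> real^4) \<Rightarrow> complex^4 \<Rightarrow> complex^4" where
  "cplx_endo A v = cplx_vec (A (Re_vec v)) (A (Im_vec v))"

definition cplx_bilinear :: "(real^4 \<Rightarrow> real^4 \<Rightarrow> real) \<Rightarrow> complex^4 \<Rightarrow> complex^4 \<Rightarrow> complex" where
  "cplx_bilinear B v w = Complex
     (B (Re_vec v) (Re_vec w) - B (Im_vec v) (Im_vec w))
     (B (Re_vec v) (Im_vec w) + B (Im_vec v) (Re_vec w))"

definition dir_deriv :: "(real^4 \<Rightarrow> complex) \<Rightarrow> real^4 \<Rightarrow> complex^4 \<Rightarrow> complex" where
  "dir_deriv f q v = frechet_derivative f (at q) (Re_vec v)
                   + \<i> * frechet_derivative f (at q) (Im_vec v)"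

type_synonym cform1 = "real^4 \<Rightarrow> complex^4 \<Rightarrow> complex"
type_synonym cform2 = "real^4 \<Rightarrow> complex^4 \<Rightarrow> complex^4 \<Rightarrow> complex"

definition form1 :: "kt_point set \<Rightarrow> cform1 \<Rightarrow> bool" where
  "form1 U \<alpha> \<longleftrightarrow>
     (\<forall>q\<in>lift U. Vector_Spaces.linear (*s) (*) (\<alpha> q)) \<and>
     (\<forall>v. smooth_on (lift U) (\<lambda>q. \<alpha> q v)) \<and>
     (\<forall>\<gamma>\<in>deck. \<forall>q\<in>lift U. \<forall>v. \<alpha> (\<gamma> q) (cplx_endo (frechet_derivative \<gamma> (at q)) v) = \<alpha> q v)"

definition wedge :: "cform1 \<Rightarrow> cform1 \<Rightarrow> cform2" (infixr "\<and>\<^sub>F" 70) where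
  "(\<alpha> \<and>\<^sub>F \<beta>) q v w = \<alpha> q v * \<beta> q w - \<alpha> q w * \<beta> q v"

definition cnj_form :: "cform1 \<Rightarrow> cform1" where
  "cnj_form \<alpha> q v = cnj (\<alpha> q (cnj_vec v))"

text \<open>Exterior derivative of a 1-form, with \<open>v\<close>, \<open>w\<close> extended to constant coordinate fields.\<close>

definition ext_deriv :: "cform1 \<Rightarrow> cform2" where
  "ext_deriv \<alpha> q v w = dir_deriv (\<lambda>r. \<alpha> r w) q v - dir_deriv (\<lambda>r. \<alpha> r v) q w"


section \<open>Connections\<close>

type_synonym connection = "(real^4 \<Rightarrow> real^4) \<Rightarrow> (real^4 \<Rightarrow> real^4) \<Rightarrow> real^4 \<Rightarrow> real^4"

text \<open>A connection acts on the sections of \<open>TM\<close> over every open set, compatibly with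
  restriction (second clause).\<close>

definition is_connection :: "connection \<Rightarrow> bool" where
  "is_connection D \<longleftrightarrow>
     (\<forall>U X Y. kt_open U \<and> vfield U X \<and> vfield U Y \<longrightarrow> vfield U (D X Y)) \<and>
     (\<forall>U X Y X' Y'. kt_open U \<and> vfield U X \<and> vfield U Y \<and> vfield U X' \<and> vfield U Y' \<and>
        (\<forall>q\<in>lift U. X q = X' q \<and> Y q = Y' q) \<longrightarrow> (\<forall>q\<in>lift U. D X Y q = D X' Y' q)) \<and>
     (\<forall>U X X' Y. kt_open U \<and> vfield U X \<and> vfield U X' \<and> vfield U Y \<longrightarrow>
        (\<forall>q\<in>lift U. D (\<lambda>r. X r + X' r) Y q = D X Y q + D X' Y q)) \<and>
     (\<forall>U X Y Y'. kt_open U \<and> vfield U X \<and> vfield U Y \<and> vfield U Y' \<longrightarrow>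
        (\<forall>q\<in>lift U. D X (\<lambda>r. Y r + Y' r) q = D X Y q + D X Y' q)) \<and>
     (\<forall>U f X Y. kt_open U \<and> kt_smooth U f \<and> vfield U X \<and> vfield U Y \<longrightarrow>
        (\<forall>q\<in>lift U. D (\<lambda>r. f (kt_proj r) *\<^sub>R X r) Y q = f (kt_proj q) *\<^sub>R D X Y q)) \<and>
     (\<forall>U f X Y. kt_open U \<and> kt_smooth U f \<and> vfield U X \<and> vfield U Y \<longrightarrow>
        (\<forall>q\<in>lift U. D X (\<lambda>r. f (kt_proj r) *\<^sub>R Y r) q =
           frechet_derivative (f \<circ> kt_proj) (at q) (X q) *\<^sub>R Y q + f (kt_proj q) *\<^sub>R D X Y q))"

definition lie_bracket :: "(real^4 \<Rightarrow> real^4) \<Rightarrow> (real^4 \<Rightarrow> real^4) \<Rightarrow> real^4 \<Rightarrow> real^4" where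
  "lie_bracket X Y q = frechet_derivative Y (at q) (X q) - frechet_derivative X (at q) (Y q)"

definition torsion_free :: "connection \<Rightarrow> bool" where
  "torsion_free D \<longleftrightarrow> (\<forall>U X Y. kt_open U \<and> vfield U X \<and> vfield U Y \<longrightarrow>
     (\<forall>q\<in>lift U. D X Y q - D Y X q = lie_bracket X Y q))"

definition preserves_metric :: "(real^4 \<Rightarrow> real^4 \<Rightarrow> real^4 \<Rightarrow> real) \<Rightarrow> connection \<Rightarrow> bool" where
  "preserves_metric g D \<longleftrightarrow> (\<forall>U X Y Z. kt_open U \<and> vfield U X \<and> vfield U Y \<and> vfield U Z \<longrightarrow>
     (\<forall>q\<in>lift U. frechet_derivative (\<lambda>r. g r (Y r) (Z r)) (at q) (X q) =
        g q (D X Y q) (Z q) + g q (Y q) (D X Z q)))"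

definition levi_civita :: "(real^4 \<Rightarrow> real^4 \<Rightarrow> real^4 \<Rightarrow> real) \<Rightarrow> connection \<Rightarrow> bool" where
  "levi_civita g D \<longleftrightarrow> is_connection D \<and> torsion_free D \<and> preserves_metric g D"

text \<open>The canonical connection of an almost Kaehler structure with almost complex structure \<open>J\<close>
  and Levi-Civita connection \<open>D\<close>.\<close>

definition canonical_conn :: "(real^4 \<Rightarrow> real^4 \<Rightarrow> real^4) \<Rightarrow> connection \<Rightarrow> connection" where
  "canonical_conn J D X Y q = (1/2) *\<^sub>R (D X Y q - J q (D X (\<lambda>r. J r (Y r)) q))"

definition cplx_conn ::
    "connection \<Rightarrow> (real^4 \<Rightarrow> complex^4) \<Rightarrow> (real^4 \<Rightarrow> complex^4) \<Rightarrow> real^4 \<Rightarrow> complex^4" where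
  "cplx_conn D X Y q = cplx_vec
     (D (Re_vec \<circ> X) (Re_vec \<circ> Y) q - D (Im_vec \<circ> X) (Im_vec \<circ> Y) q)
     (D (Re_vec \<circ> X) (Im_vec \<circ> Y) q + D (Im_vec \<circ> X) (Re_vec \<circ> Y) q)"


section \<open>Local unitary frames, Ricci and scalar curvature in complex dimension 2\<close>

definition T10 :: "(real^4 \<Rightarrow> real^4 \<Rightarrow> real^4) \<Rightarrow> real^4 \<Rightarrow> (complex^4) set" where
  "T10 J q = {v. cplx_endo (J q) v = \<i> *s v}"

definition unitary_frame ::
    "(real^4 \<Rightarrow> real^4 \<Rightarrow> real^4 \<Rightarrow> real) \<Rightarrow> (real^4 \<Rightarrow> real^4 \<Rightarrow> real^4) \<Rightarrow>
     kt_point set \<Rightarrow> (2 \<Rightarrow> real^4 \<Rightarrow> complex^4) \<Rightarrow> bool" where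
  "unitary_frame g J U z \<longleftrightarrow>
     (\<forall>j. cvfield U (z j)) \<and>
     (\<forall>q\<in>lift U. (\<forall>j. z j q \<in> T10 J q) \<and> (\<forall>v\<in>T10 J q. \<exists>!c. v = (\<Sum>j\<in>UNIV. c j *s z j q))) \<and>
     (\<forall>q\<in>lift U. \<forall>i j. cplx_bilinear (g q) (z i q) (cnj_vec (z j q)) = (if i = j then 1 else 0))"

text \<open>The dual coframe consists of \<open>(1,0)\<close>-forms, i.e. it annihilates the conjugate frame.\<close>

definition dual_coframe ::
    "kt_point set \<Rightarrow> (2 \<Rightarrow> real^4 \<Rightarrow> complex^4) \<Rightarrow> (2 \<Rightarrow> cform1) \<Rightarrow> bool" where
  "dual_coframe U z zd \<longleftrightarrow>
     (\<forall>i. form1 U (zd i)) \<and>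
     (\<forall>q\<in>lift U. \<forall>i j. zd i q (z j q) = (if i = j then 1 else 0) \<and> zd i q (cnj_vec (z j q)) = 0)"

text \<open>\<open>\<theta> i j\<close> is the form with upper index \<open>i\<close> and lower index \<open>j\<close>.\<close>

definition connection_forms ::
    "connection \<Rightarrow> kt_point set \<Rightarrow> (2 \<Rightarrow> real^4 \<Rightarrow> complex^4) \<Rightarrow> (2 \<Rightarrow> 2 \<Rightarrow> cform1) \<Rightarrow> bool" where
  "connection_forms D U z \<theta> \<longleftrightarrow>
     (\<forall>i j. form1 U (\<theta> i j)) \<and>
     (\<forall>X j. cvfield U X \<longrightarrow>
        (\<forall>q\<in>lift U. cplx_conn D X (z j) q = (\<Sum>i\<in>UNIV. \<theta> i j q (X q) *s z i q)))"

definition curvature_form :: "(2 \<Rightarrow> 2 \<Rightarrow> cform1) \<Rightarrow> 2 \<Rightarrow> 2 \<Rightarrow> cform2" where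
  "curvature_form \<theta> i j q v w =
     ext_deriv (\<theta> i j) q v w + (\<Sum>k\<in>UNIV. (\<theta> i k \<and>\<^sub>F \<theta> k j) q v w)"

definition proj10 :: "(real^4 \<Rightarrow> real^4 \<Rightarrow> real^4) \<Rightarrow> real^4 \<Rightarrow> complex^4 \<Rightarrow> complex^4" where
  "proj10 J q v = (1/2) *s (v - \<i> *s cplx_endo (J q) v)"

definition proj01 :: "(real^4 \<Rightarrow> real^4 \<Rightarrow> real^4) \<Rightarrow> real^4 \<Rightarrow> complex^4 \<Rightarrow> complex^4" where
  "proj01 J q v = (1/2) *s (v + \<i> *s cplx_endo (J q) v)"

definition part11 :: "(real^4 \<Rightarrow> real^4 \<Rightarrow> real^4) \<Rightarrow> cform2 \<Rightarrow> cform2" where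
  "part11 J \<Psi> q v w = \<Psi> q (proj10 J q v) (proj01 J q w) + \<Psi> q (proj01 J q v) (proj10 J q w)"

text \<open>\<open>R i j k l\<close> stands for \<open>R\<close> with upper index \<open>i\<close> and lower indices \<open>j\<close>, \<open>k\<close>, \<open>l\<close>-bar.\<close>

definition curvature_coeffs ::
    "(real^4 \<Rightarrow> real^4 \<Rightarrow> real^4) \<Rightarrow> kt_point set \<Rightarrow> (2 \<Rightarrow> cform1) \<Rightarrow> (2 \<Rightarrow> 2 \<Rightarrow> cform1) \<Rightarrow>
     (2 \<Rightarrow> 2 \<Rightarrow> 2 \<Rightarrow> 2 \<Rightarrow> kt_point \<Rightarrow> complex) \<Rightarrow> bool" where
  "curvature_coeffs J U zd \<theta> R \<longleftrightarrow>
     (\<forall>i j. \<forall>q\<in>lift U. \<forall>v w. part11 J (curvature_form \<theta> i j) q v w =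
        (\<Sum>k\<in>UNIV. \<Sum>l\<in>UNIV. R i j k l (kt_proj q) * (zd k \<and>\<^sub>F cnj_form (zd l)) q v w))"

definition ricci_coeff ::
    "(2 \<Rightarrow> 2 \<Rightarrow> 2 \<Rightarrow> 2 \<Rightarrow> kt_point \<Rightarrow> complex) \<Rightarrow> 2 \<Rightarrow> 2 \<Rightarrow> kt_point \<Rightarrow> complex" where
  "ricci_coeff R k l p = (\<Sum>i\<in>UNIV. R i i k l p)"

definition ricci_form ::
    "(2 \<Rightarrow> cform1) \<Rightarrow> (2 \<Rightarrow> 2 \<Rightarrow> 2 \<Rightarrow> 2 \<Rightarrow> kt_point \<Rightarrow> complex) \<Rightarrow> cform2" where
  "ricci_form zd R q v w =
     (\<Sum>k\<in>UNIV. \<Sum>l\<in>UNIV. ricci_coeff R k l (kt_proj q) * (zd k \<and>\<^sub>F cnj_form (zd l)) q v w)"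

definition scalar_curv ::
    "(2 \<Rightarrow> 2 \<Rightarrow> 2 \<Rightarrow> 2 \<Rightarrow> kt_point \<Rightarrow> complex) \<Rightarrow> kt_point \<Rightarrow> complex" where
  "scalar_curv R p = (\<Sum>k\<in>UNIV. ricci_coeff R k k p)"


section \<open>The almost Kaehler structure \<open>X\<^sub>a\<close>\<close>

definition frame :: "4 \<Rightarrow> real^4 \<Rightarrow> real^4" where
  "frame k q = (if k = 3 then axis 3 1 + (q $ 2) *\<^sub>R axis 4 1 else axis k 1)"

definition coframe :: "4 \<Rightarrow> real^4 \<Rightarrow> real^4 \<Rightarrow> real" where
  "coframe k q v = (if k = 4 then v $ 4 - q $ 2 * v $ 3 else v $ k)"

text \<open>\<open>J_a e\<^sub>1 = e\<^sub>2\<close>, \<open>J_a e\<^sub>2 = - e\<^sub>1\<close>, \<open>J_a e\<^sub>3 = (1/a) e\<^sub>4\<close>, \<open>J_a e\<^sub>4 = - a e\<^sub>3\<close>.\<close>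

definition kt_J :: "real \<Rightarrow> real^4 \<Rightarrow> real^4 \<Rightarrow> real^4" where
  "kt_J a q v = coframe 1 q v *\<^sub>R frame 2 q - coframe 2 q v *\<^sub>R frame 1 q
              + (coframe 3 q v / a) *\<^sub>R frame 4 q - (a * coframe 4 q v) *\<^sub>R frame 3 q"

definition kt_omega :: "real^4 \<Rightarrow> real^4 \<Rightarrow> real^4 \<Rightarrow> real" where
  "kt_omega q v w =
     coframe 1 q v * coframe 2 q w - coframe 1 q w * coframe 2 q v
   + coframe 3 q v * coframe 4 q w - coframe 3 q w * coframe 4 q v"

definition kt_metric :: "real \<Rightarrow> real^4 \<Rightarrow> real^4 \<Rightarrow> real^4 \<Rightarrow> real" where
  "kt_metric a q v w = kt_omega q v (kt_J a q w)"

end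

theory Submission
  imports Defs
begin

text \<open>Since \<open>tr(\<theta> \<and> \<theta>) = 0\<close>, the trace of the curvature is \<open>d(tr \<theta>)\<close>. In the left-invariant frame
  \<open>e\<^sub>1 - i e\<^sub>2\<close>, \<open>e\<^sub>3 - (i/a) e\<^sub>4\<close> of \<open>T\<^sup>1\<^sup>,\<^sup>0\<close>, Koszul's formula gives the trace of the connection matrix
  as \<open>(i a / 2) dx\<close>. A change of frame with matrix \<open>G\<close> adds \<open>d log det G\<close>, so for every unitary frame
  \<open>tr \<theta> = d log det G + (i a / 2) dx\<close>, which is closed. Hence the whole trace of the curvature
  vanishes, in particular its \<open>(1,1)\<close>-part.\<close>

section \<open>Symmetry of second derivatives\<close>

text \<open>The mean value theorem, applied along \<open>u\<close> to the difference of
  \<open>f\<close> at points shifted by \<open>t v\<close>, leaves a difference of values of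
  \<open>f' _ u\<close>. Differentiability of \<open>f' _ u\<close> at \<open>x\<close> then turns
  that into \<open>t * A v\<close> up to \<open>e * t\<close>. The second derivative is used at the
  single point \<open>x\<close>, with no continuity of it.\<close>

lemma second_difference_approx:
  fixes f :: "'a::real_normed_vector \<Rightarrow> real"
  assumes S: "open S" "x \<in> S"
    and f': "\<And>y. y \<in> S \<Longrightarrow> (f has_derivative f' y) (at y)"
    and A: "((\<lambda>y. f' y u) has_derivative A) (at x)"
    and e: "e > 0"
  shows "\<exists>d>0. \<forall>t. 0 < t \<and> t < d \<longrightarrow>
    \<bar>f (x + t *\<^sub>R u + t *\<^sub>R v) - f (x + t *\<^sub>R u) - f (x + t *\<^sub>R v) + f x - t\<^sup>2 * A v\<bar> \<le> e * t\<^sup>2"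
proof -
  \<comment> \<open>\<open>2 * norm u + norm v\<close> bounds, per unit of \<open>t\<close>, the sum
    of the norms of the two displacements compared below; the summand 1 keeps \<open>K\<close>
    positive even for \<open>u = v = 0\<close>.\<close>
  define K where "K = 2 * norm u + norm v + 1"
  have K: "K > 0" by (simp add: K_def add_nonneg_pos)
  obtain d1 where d1: "d1 > 0" "ball x d1 \<subseteq> S"
    using S open_contains_ball by metis
  have linA: "linear A" using A by (rule has_derivative_linear)
  obtain d2 where d2: "d2 > 0"
    "\<And>y. norm (y - x) < d2 \<Longrightarrow> \<bar>f' y u - f' x u - A (y - x)\<bar> \<le> e / K * norm (y - x)"
    using A e K unfolding has_derivative_at_alt
    by (metis divide_pos_pos real_norm_def)
  define d where "d = min d1 d2 / K"
  have "d > 0" using d1 d2 K by (simp add: d_def)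
  moreover have "\<bar>f (x + t *\<^sub>R u + t *\<^sub>R v) - f (x + t *\<^sub>R u) - f (x + t *\<^sub>R v) + f x - t\<^sup>2 * A v\<bar>
      \<le> e * t\<^sup>2" if t: "0 < t" "t < d" for t
  proof -
    have tK: "t * K < min d1 d2" using t K by (simp add: d_def pos_less_divide_eq)
    have small: "norm (s *\<^sub>R u + t *\<^sub>R v) < min d1 d2" "norm (s *\<^sub>R u) < min d1 d2"
      "norm (s *\<^sub>R u + t *\<^sub>R v) + norm (s *\<^sub>R u) \<le> t * K"
      if s: "0 \<le> s" "s \<le> t" for s
    proof -
      have a: "norm (s *\<^sub>R u) \<le> t * norm u" using s by (simp add: mult_right_mono)
      have b: "norm (s *\<^sub>R u + t *\<^sub>R v) \<le> norm (s *\<^sub>R u) + t * norm v"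
        using norm_triangle_ineq[of "s *\<^sub>R u" "t *\<^sub>R v"] t by simp
      have c: "t * K = 2 * (t * norm u) + t * norm v + t" by (simp add: K_def algebra_simps)
      have n: "0 \<le> t * norm u" "0 \<le> t * norm v" using t by simp_all
      show "norm (s *\<^sub>R u + t *\<^sub>R v) < min d1 d2" using a b c n tK t(1) by linarith
      show "norm (s *\<^sub>R u) < min d1 d2" using a c n tK t(1) by linarith
      show "norm (s *\<^sub>R u + t *\<^sub>R v) + norm (s *\<^sub>R u) \<le> t * K" using a b c n t(1) by linarith
    qed
    \<comment> \<open>The second difference is \<open>\<phi> t - \<phi> 0\<close>.\<close>
    define \<phi> where "\<phi> s = f (x + s *\<^sub>R u + t *\<^sub>R v) - f (x + s *\<^sub>R u)" for s
    have der: "(\<phi> has_derivative (\<lambda>h. h * (f' (x + s *\<^sub>R u + t *\<^sub>R v) u - f' (x + s *\<^sub>R u) u)))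
        (at s within {0..t})" if s: "0 \<le> s" "s \<le> t" for s
    proof -
      have m: "x + s *\<^sub>R u + t *\<^sub>R v \<in> S" "x + s *\<^sub>R u \<in> S"
        using small[OF s] d1(2) by (auto simp: subset_iff dist_norm norm_minus_commute add.assoc)
      have l: "linear (f' (x + s *\<^sub>R u + t *\<^sub>R v))" "linear (f' (x + s *\<^sub>R u))"
        using f'[OF m(1)] f'[OF m(2)] has_derivative_linear by blast+
      have "((\<lambda>s. f (x + s *\<^sub>R u + t *\<^sub>R v)) has_derivative (\<lambda>h. f' (x + s *\<^sub>R u + t *\<^sub>R v) (h *\<^sub>R u)))
          (at s within {0..t})"
        by (rule has_derivative_compose[where f = "\<lambda>s. x + s *\<^sub>R u + t *\<^sub>R v" and g = f, OF _ f'[OF m(1)]])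
          (auto intro!: derivative_eq_intros)
      moreover have "((\<lambda>s. f (x + s *\<^sub>R u)) has_derivative (\<lambda>h. f' (x + s *\<^sub>R u) (h *\<^sub>R u)))
          (at s within {0..t})"
        by (rule has_derivative_compose[where f = "\<lambda>s. x + s *\<^sub>R u" and g = f, OF _ f'[OF m(2)]])
          (auto intro!: derivative_eq_intros)
      ultimately have "(\<phi> has_derivative (\<lambda>h. f' (x + s *\<^sub>R u + t *\<^sub>R v) (h *\<^sub>R u) - f' (x + s *\<^sub>R u) (h *\<^sub>R u)))
          (at s within {0..t})"
        unfolding \<phi>_def by (rule has_derivative_diff)
      then show ?thesis
        by (simp add: linear_cmul[OF l(1)] linear_cmul[OF l(2)] right_diff_distrib)
    qed
    obtain s where s: "s \<in> {0..t}"
      "\<phi> t - \<phi> 0 = (t - 0) * (f' (x + s *\<^sub>R u + t *\<^sub>R v) u - f' (x + s *\<^sub>R u) u)"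
      using mvt_very_simple[of 0 t \<phi>, OF less_imp_le[OF t(1)] der] by blast
    then have s0: "0 \<le> s" "s \<le> t" by auto
    define p where "p = s *\<^sub>R u + t *\<^sub>R v"
    have b1: "\<bar>f' (x + p) u - f' x u - A p\<bar> \<le> e / K * norm p"
      using d2(2)[of "x + p"] small[OF s0] by (simp add: p_def)
    have b2: "\<bar>f' (x + s *\<^sub>R u) u - f' x u - A (s *\<^sub>R u)\<bar> \<le> e / K * norm (s *\<^sub>R u)"
      using d2(2)[of "x + s *\<^sub>R u"] small[OF s0] by simp
    have Ap: "A p = A (s *\<^sub>R u) + t * A v"
      by (simp add: p_def linear_add[OF linA] linear_cmul[OF linA])
    \<comment> \<open>Subtracting the linear approximations at \<open>x + p\<close> and
      \<open>x + s *\<^sub>R u\<close> cancels \<open>f' x u\<close> and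
      \<open>A (s *\<^sub>R u)\<close>; the two errors add up.\<close>
    have "\<bar>(f' (x + p) u - f' (x + s *\<^sub>R u) u) - t * A v\<bar> \<le> e / K * (norm p + norm (s *\<^sub>R u))"
      using b1 b2 unfolding Ap distrib_left by linarith
    also have "\<dots> \<le> e / K * (t * K)"
      using small(3)[OF s0] e K unfolding p_def by (intro mult_left_mono) auto
    also have "\<dots> = e * t" using K by simp
    finally have "t * \<bar>(f' (x + p) u - f' (x + s *\<^sub>R u) u) - t * A v\<bar> \<le> t * (e * t)"
      using t(1) by (intro mult_left_mono) auto
    then have "\<bar>t * ((f' (x + p) u - f' (x + s *\<^sub>R u) u) - t * A v)\<bar> \<le> e * t\<^sup>2"
      using t(1) by (simp add: abs_mult power2_eq_square mult_ac)
    moreover have "f (x + t *\<^sub>R u + t *\<^sub>R v) - f (x + t *\<^sub>R u) - f (x + t *\<^sub>R v) + f x - t\<^sup>2 * A v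
        = t * ((f' (x + p) u - f' (x + s *\<^sub>R u) u) - t * A v)"
      using s(2) by (simp add: \<phi>_def p_def power2_eq_square algebra_simps)
    ultimately show ?thesis by simp
  qed
  ultimately show ?thesis by blast
qed

text \<open>The second difference does not change when \<open>u\<close> and \<open>v\<close> are
  exchanged, so \<open>A v\<close> and \<open>B u\<close> are both its limit after division by the
  square of \<open>t\<close>.\<close>

lemma second_derivative_symmetric_real:
  fixes f :: "'a::real_normed_vector \<Rightarrow> real"
  assumes S: "open S" "x \<in> S"
    and f': "\<And>y. y \<in> S \<Longrightarrow> (f has_derivative f' y) (at y)"
    and A: "((\<lambda>y. f' y u) has_derivative A) (at x)"
    and B: "((\<lambda>y. f' y v) has_derivative B) (at x)"
  shows "A v = B u"
proof -
  have "\<bar>A v - B u\<bar> \<le> e" if e: "e > 0" for e :: real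
  proof -
    obtain d1 where d1: "d1 > 0" "\<And>t. 0 < t \<Longrightarrow> t < d1 \<Longrightarrow>
      \<bar>f (x + t *\<^sub>R u + t *\<^sub>R v) - f (x + t *\<^sub>R u) - f (x + t *\<^sub>R v) + f x - t\<^sup>2 * A v\<bar> \<le> e/2 * t\<^sup>2"
      using second_difference_approx[OF S f' A, of "e/2" v] e by auto
    obtain d2 where d2: "d2 > 0" "\<And>t. 0 < t \<Longrightarrow> t < d2 \<Longrightarrow>
      \<bar>f (x + t *\<^sub>R v + t *\<^sub>R u) - f (x + t *\<^sub>R v) - f (x + t *\<^sub>R u) + f x - t\<^sup>2 * B u\<bar> \<le> e/2 * t\<^sup>2"
      using second_difference_approx[OF S f' B, of "e/2" u] e by auto
    define t where "t = min d1 d2 / 2"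
    have t: "0 < t" "t < d1" "t < d2" using d1(1) d2(1) by (auto simp: t_def)
    have comm: "x + t *\<^sub>R v + t *\<^sub>R u = x + t *\<^sub>R u + t *\<^sub>R v" by (simp add: add_ac)
    have "\<bar>t\<^sup>2 * A v - t\<^sup>2 * B u\<bar> \<le> e * t\<^sup>2"
      using d1(2)[OF t(1,2)] d2(2)[OF t(1,3)] unfolding comm abs_le_iff by linarith
    moreover have "\<bar>t\<^sup>2 * A v - t\<^sup>2 * B u\<bar> = t\<^sup>2 * \<bar>A v - B u\<bar>"
      unfolding right_diff_distrib[symmetric] abs_mult by simp
    ultimately have "t\<^sup>2 * \<bar>A v - B u\<bar> \<le> t\<^sup>2 * e"
      by (simp add: mult.commute)
    then show ?thesis using t(1) by simp
  qed
  then have "\<bar>A v - B u\<bar> \<le> 0" by (rule field_le_epsilon[of _ 0, simplified])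
  then show ?thesis by simp
qed

text \<open>Pairing with the fixed vector \<open>c = A v - B u\<close> reduces to the real case and
  gives \<open>c \<bullet> c = 0\<close>. It is applied later to a complex-valued
  determinant.\<close>

lemma second_derivative_symmetric:
  fixes f :: "'a::real_normed_vector \<Rightarrow> 'b::real_inner"
  assumes S: "open S" "x \<in> S"
    and f': "\<And>y. y \<in> S \<Longrightarrow> (f has_derivative f' y) (at y)"
    and A: "((\<lambda>y. f' y u) has_derivative A) (at x)"
    and B: "((\<lambda>y. f' y v) has_derivative B) (at x)"
  shows "A v = B u"
proof -
  define c where "c = A v - B u"
  have "A v \<bullet> c = B u \<bullet> c"
    by (rule second_derivative_symmetric_real[OF S,
          where f = "\<lambda>y. f y \<bullet> c" and f' = "\<lambda>y h. f' y h \<bullet> c"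
            and A = "\<lambda>h. A h \<bullet> c" and B = "\<lambda>h. B h \<bullet> c"])
      (use f' A B in \<open>auto intro: has_derivative_inner_left\<close>)
  then have "c \<bullet> c = 0" by (simp add: c_def inner_diff_left)
  then show ?thesis by (simp add: c_def)
qed

section \<open>Smooth maps on open sets\<close>

lemma frechet_derivative_cong_open:
  assumes "open S" "x \<in> S" "\<And>y. y \<in> S \<Longrightarrow> f y = g y"
  shows "frechet_derivative f (at x) = frechet_derivative g (at x)"
proof -
  \<comment> \<open>\<open>frechet_derivative\<close> is a choice among all derivatives, so equality
    follows once both functions admit the same ones, even where there are none.\<close>
  have "(f has_derivative F) (at x) \<longleftrightarrow> (g has_derivative F) (at x)" for F
    using has_derivative_transform_within_open[OF _ assms(1,2), of f F UNIV g]
      has_derivative_transform_within_open[OF _ assms(1,2), of g F UNIV f] assms(3) by auto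
  then show ?thesis unfolding frechet_derivative_def by simp
qed

lemma Ck_on_cong:
  assumes "open S" "\<And>q. q \<in> S \<Longrightarrow> f q = g q" "Ck_on n S f"
  shows "Ck_on n S g"
  using assms(2,3)
proof (induction n arbitrary: f g)
  case 0
  have "continuous_on S f" using 0(2) by simp
  then have "continuous_on S g" by (rule continuous_on_eq) (rule 0(1))
  then show ?case by simp
next
  case (Suc n)
  have "g differentiable at q" if "q \<in> S" for q
  proof -
    have "f differentiable (at q)" using Suc.prems(2) that by simp
    then obtain f' where "(f has_derivative f') (at q)" unfolding differentiable_def ..
    then have "(g has_derivative f') (at q)"
      using has_derivative_transform_within_open[OF _ assms(1) that] Suc.prems(1) by blast
    then show ?thesis by (auto simp: differentiable_def)
  qed
  moreover have "Ck_on n S (\<lambda>q. frechet_derivative g (at q) (axis i 1))" for i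
  proof (rule Suc.IH)
    show "Ck_on n S (\<lambda>q. frechet_derivative f (at q) (axis i 1))" using Suc.prems(2) by simp
    show "frechet_derivative f (at q) (axis i 1) = frechet_derivative g (at q) (axis i 1)"
      if "q \<in> S" for q
      by (rule arg_cong[OF frechet_derivative_cong_open[OF assms(1) that Suc.prems(1)]])
  qed
  ultimately show ?case by simp
qed

lemma Ck_on_const: "Ck_on n S (\<lambda>q. c)"
  by (induction n arbitrary: c) simp_all

lemma smooth_on_affine:
  assumes "bounded_linear L"
  shows "smooth_on S (\<lambda>q. c + L q)"
proof -
  have der: "((\<lambda>q. c + L q) has_derivative L) (at q)" for q
    using assms by (auto intro!: derivative_eq_intros bounded_linear_imp_has_derivative)
  have "Ck_on n S (\<lambda>q. c + L q)" for n
  proof (cases n)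
    case 0
    then show ?thesis
      using der by (auto intro: continuous_at_imp_continuous_on has_derivative_continuous)
  next
    case (Suc m)
    have "frechet_derivative (\<lambda>q. c + L q) (at q) = L" for q
      using der frechet_derivative_at by metis
    then show ?thesis using Suc der by (auto intro: differentiableI Ck_on_const)
  qed
  then show ?thesis by (simp add: smooth_on_def)
qed

lemma smooth_on_differentiable: "smooth_on S f \<Longrightarrow> q \<in> S \<Longrightarrow> f differentiable at q"
  unfolding smooth_on_def by (metis Ck_on.simps(2))

lemma Ck_on_minus:
  assumes "open S" "Ck_on n S f"
  shows "Ck_on n S (\<lambda>q. - f q)"
  using assms(2)
proof (induction n arbitrary: f)
  case 0
  then show ?case by (simp add: continuous_on_minus)
next
  case (Suc n)
  have "frechet_derivative (\<lambda>q. - f q) (at q) = (\<lambda>h. - frechet_derivative f (at q) h)" if "q \<in> S" for q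
  proof -
    have "(f has_derivative frechet_derivative f (at q)) (at q)"
      using Suc.prems that by (simp add: frechet_derivative_works[symmetric])
    from frechet_derivative_at[OF has_derivative_minus[OF this]] show ?thesis ..
  qed
  note der = this
  have "Ck_on n S (\<lambda>q. frechet_derivative (\<lambda>q. - f q) (at q) (axis i 1))" for i
  proof (rule Ck_on_cong[OF assms(1)])
    show "Ck_on n S (\<lambda>q. - frechet_derivative f (at q) (axis i 1))"
      using Suc.prems by (intro Suc.IH) simp
  qed (simp add: der)
  then show ?case using Suc.prems by (simp add: differentiable_minus)
qed

section \<open>Invariant vector fields on the covering and the global frame\<close>

lemma kt_open_lift: "kt_open U \<Longrightarrow> open (lift U)"
  by (simp add: kt_open_def)

text \<open>Deck maps are affine: everything is translation except the shear that left
  multiplication by an integer matrix produces in the last coordinate.\<close>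

lemma frechet_derivative_deck_map:
  "frechet_derivative (deck_map k m n r) (at q)
    = (\<lambda>u. vector [u $ 1, u $ 2, u $ 3, u $ 4 + of_int m * u $ 3])"
proof -
  define c :: "real^4" where "c = vector [2 * pi * of_int k, of_int m, of_int n, of_int r]"
  define L :: "real^4 \<Rightarrow> real^4" where
    "L u = vector [u $ 1, u $ 2, u $ 3, u $ 4 + of_int m * u $ 3]" for u
  have "linear L"
    by (rule linearI) (simp_all add: L_def vec_eq_iff forall_4 algebra_simps)
  then have "bounded_linear L" by (rule linear_conv_bounded_linear[THEN iffD1])
  then have "((\<lambda>u. c + L u) has_derivative L) (at q)"
    using has_derivative_add[OF has_derivative_const bounded_linear_imp_has_derivative] by fastforce
  moreover have "deck_map k m n r = (\<lambda>u. c + L u)"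
    by (simp add: fun_eq_iff deck_map_def vec_eq_iff forall_4 L_def c_def)
  ultimately have "frechet_derivative (deck_map k m n r) (at q) = L"
    using frechet_derivative_at by metis
  then show ?thesis by (simp add: fun_eq_iff L_def)
qed

lemma deck_lift: "\<gamma> \<in> deck \<Longrightarrow> q \<in> lift U \<Longrightarrow> \<gamma> q \<in> lift U"
  using kt_proj_eq_iff[of q "\<gamma> q"] by auto

text \<open>Needed because identities such as \<open>J Y = - W\<close> for the real and imaginary
  parts of a (1,0)-field are available only over \<open>U\<close>; deck maps preserve
  \<open>lift U\<close>, so invariance transfers as well.\<close>

lemma vfield_cong:
  assumes "kt_open U" "\<And>q. q \<in> lift U \<Longrightarrow> X q = Y q" "vfield U X"
  shows "vfield U Y"
  unfolding vfield_def
proof (intro conjI ballI)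
  show "smooth_on (lift U) Y"
    using assms(3) Ck_on_cong[OF kt_open_lift[OF assms(1)], of X Y] assms(2)
    unfolding vfield_def smooth_on_def by blast
next
  fix \<gamma> q assume g: "\<gamma> \<in> deck" and q: "q \<in> lift U"
  then have "X (\<gamma> q) = frechet_derivative \<gamma> (at q) (X q)"
    using assms(3) unfolding vfield_def by blast
  then show "Y (\<gamma> q) = frechet_derivative \<gamma> (at q) (Y q)"
    using assms(2)[OF q] assms(2)[OF deck_lift[OF g q]] by simp
qed

lemma vfield_minus:
  assumes "kt_open U" "vfield U X"
  shows "vfield U (\<lambda>q. - X q)"
  unfolding vfield_def
proof (intro conjI ballI)
  show "smooth_on (lift U) (\<lambda>q. - X q)"
    using assms(2) Ck_on_minus[OF kt_open_lift[OF assms(1)]]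
    unfolding vfield_def smooth_on_def by blast
next
  fix \<gamma> q assume g: "\<gamma> \<in> deck" and q: "q \<in> lift U"
  then have "X (\<gamma> q) = frechet_derivative \<gamma> (at q) (X q)"
    using assms(2) unfolding vfield_def by blast
  moreover obtain k m n r where "\<gamma> = deck_map k m n r" using g by (auto simp: deck_def)
  ultimately show "- X (\<gamma> q) = frechet_derivative \<gamma> (at q) (- X q)"
    by (simp add: frechet_derivative_deck_map vec_eq_iff forall_4)
qed

lemma vfield_zero: "vfield U (\<lambda>q. 0)"
  unfolding vfield_def
proof (intro conjI ballI)
  show "smooth_on (lift U) (\<lambda>q. 0 :: real^4)" by (simp add: smooth_on_def Ck_on_const)
next
  fix \<gamma> and q :: "real^4" assume "\<gamma> \<in> deck"
  then obtain k m n r where "\<gamma> = deck_map k m n r" by (auto simp: deck_def)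
  then show "0 = frechet_derivative \<gamma> (at q) 0"
    by (simp add: frechet_derivative_deck_map vec_eq_iff forall_4)
qed

lemma frame_nth: "frame k q $ i = (if k = i then 1 else if k = 3 \<and> i = 4 then q $ 2 else 0)"
  by (simp add: frame_def axis_def)

lemma bounded_linear_frame_part:
  "bounded_linear (\<lambda>u::real^4. if k = (3::4) then (u $ 2) *\<^sub>R (axis 4 1 :: real^4) else 0)"
  by (intro linear_conv_bounded_linear[THEN iffD1] linearI) (auto simp: algebra_simps)

lemma frame_affine:
  "frame k = (\<lambda>q. axis k 1 + (if k = 3 then (q $ 2) *\<^sub>R axis 4 1 else 0))"
  by (auto simp: frame_def)

lemma frechet_derivative_frame:
  "frechet_derivative (frame k) (at q) = (\<lambda>u. if k = 3 then (u $ 2) *\<^sub>R axis 4 1 else 0)"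
proof -
  have "(frame k has_derivative (\<lambda>u. if k = 3 then (u $ 2) *\<^sub>R axis 4 1 else 0)) (at q)"
    unfolding frame_affine
    using has_derivative_add[OF has_derivative_const
        bounded_linear_imp_has_derivative[OF bounded_linear_frame_part]] by simp
  then show ?thesis by (metis frechet_derivative_at)
qed

text \<open>The frame is left-invariant: a deck map moves the coefficient \<open>q $ 2\<close> of
  e_3 by the integer \<open>m\<close>, which is exactly the shear in its differential.\<close>

lemma vfield_frame: "vfield U (frame k)"
proof -
  have "smooth_on (lift U) (frame k)"
    unfolding frame_affine by (rule smooth_on_affine[OF bounded_linear_frame_part])
  moreover have "frame k (\<gamma> q) = frechet_derivative \<gamma> (at q) (frame k q)" if "\<gamma> \<in> deck" for \<gamma> q
    using that exhaust_4[of k]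
    by (auto simp: deck_def frechet_derivative_deck_map vec_eq_iff forall_4 frame_nth deck_map_def)
  ultimately show ?thesis by (simp add: vfield_def)
qed

section \<open>The almost Kaehler structure in frame components\<close>

lemma coframe_simps:
  "coframe 1 q v = v $ 1" "coframe 2 q v = v $ 2" "coframe 3 q v = v $ 3"
  "coframe 4 q v = v $ 4 - q $ 2 * v $ 3"
  by (simp_all add: coframe_def)

lemma kt_J_nth:
  "kt_J a q v $ 1 = - v $ 2" "kt_J a q v $ 2 = v $ 1"
  "kt_J a q v $ 3 = - a * coframe 4 q v"
  "kt_J a q v $ 4 = v $ 3 / a - a * q $ 2 * coframe 4 q v"
  by (simp_all add: kt_J_def frame_nth coframe_simps)

lemma coframe_kt_J:
  "coframe 1 q (kt_J a q v) = - v $ 2" "coframe 2 q (kt_J a q v) = v $ 1"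
  "coframe 3 q (kt_J a q v) = - a * coframe 4 q v" "coframe 4 q (kt_J a q v) = v $ 3 / a"
  by (simp_all add: coframe_def kt_J_nth algebra_simps)

lemma kt_metric_coframe:
  assumes "a \<noteq> 0"
  shows "kt_metric a q v w = v $ 1 * w $ 1 + v $ 2 * w $ 2 + v $ 3 * w $ 3 / a
    + a * coframe 4 q v * coframe 4 q w"
  using assms by (simp add: kt_metric_def kt_omega_def coframe_simps kt_J_nth field_simps)

lemma kt_metric_frame_left:
  assumes "a \<noteq> 0"
  shows "kt_metric a q v w = (\<Sum>l\<in>UNIV. coframe l q v * kt_metric a q (frame l q) w)"
  using assms by (simp add: kt_metric_coframe sum_4 coframe_simps frame_nth)

text \<open>All indices are lowered with \<open>g\<^sub>a\<close>: these are \<open>g\<^sub>a([e\<^sub>k, e\<^sub>l], e\<^sub>m)\<close> and, by Koszul's formula,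
  \<open>g\<^sub>a(D e\<^sub>k e\<^sub>l, e\<^sub>m)\<close>.\<close>

definition bracket_coeff :: "real \<Rightarrow> 4 \<Rightarrow> 4 \<Rightarrow> 4 \<Rightarrow> real" where
  "bracket_coeff a k l m = (if k = 2 \<and> l = 3 \<and> m = 4 then a
     else if k = 3 \<and> l = 2 \<and> m = 4 then - a else 0)"

definition christoffel :: "real \<Rightarrow> 4 \<Rightarrow> 4 \<Rightarrow> 4 \<Rightarrow> real" where
  "christoffel a k l m =
     (bracket_coeff a k l m - bracket_coeff a l m k + bracket_coeff a m k l) / 2"

section \<open>The Levi-Civita connection in the invariant frame\<close>

text \<open>The value \<open>a\<close> arises as g(e_4, e_4), the result of lowering the index in
  [e_2, e_3] = e_4.\<close>

lemma lie_bracket_frame: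
  assumes "a \<noteq> 0"
  shows "kt_metric a q (lie_bracket (frame k) (frame l) q) (frame m q) = bracket_coeff a k l m"
  using exhaust_4[of k] exhaust_4[of l] exhaust_4[of m] assms
  by (auto simp: lie_bracket_def frechet_derivative_frame kt_metric_coframe coframe_simps frame_nth
      bracket_coeff_def axis_def)

lemma kt_metric_commute: "a \<noteq> 0 \<Longrightarrow> kt_metric a q v w = kt_metric a q w v"
  by (simp add: kt_metric_coframe)

lemma kt_metric_diff_left:
  "a \<noteq> 0 \<Longrightarrow> kt_metric a q (v - v') w = kt_metric a q v w - kt_metric a q v' w"
  by (simp add: kt_metric_coframe coframe_simps algebra_simps diff_divide_distrib)

lemma levi_civita_frame:
  assumes a: "a \<noteq> 0" and D: "levi_civita (kt_metric a) D" and U: "kt_open U" and q: "q \<in> lift U"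
  shows "kt_metric a q (D (frame k) (frame l) q) (frame m q) = christoffel a k l m"
proof -
  define G where "G k l m = kt_metric a q (D (frame k) (frame l) q) (frame m q)" for k l m
  \<comment> \<open>Products of frame fields are constant, so the derivative terms of Koszul's
    formula vanish; the base point 0 is arbitrary.\<close>
  have const: "(\<lambda>r. kt_metric a r (frame l r) (frame m r)) = (\<lambda>r. kt_metric a 0 (frame l 0) (frame m 0))" for l m
    using exhaust_4[of l] exhaust_4[of m] a
    by (auto simp: fun_eq_iff kt_metric_coframe coframe_simps frame_nth)
  have skew: "G k l m + G k m l = 0" for k l m
  proof -
    have "frechet_derivative (\<lambda>r. kt_metric a r (frame l r) (frame m r)) (at q) (frame k q)
        = kt_metric a q (D (frame k) (frame l) q) (frame m q)
        + kt_metric a q (frame l q) (D (frame k) (frame m) q)"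
      using D U q vfield_frame unfolding levi_civita_def preserves_metric_def by blast
    then show ?thesis
      unfolding const G_def by (simp add: kt_metric_commute[OF a, of q "frame l q"])
  qed
  have tor: "G k l m - G l k m = bracket_coeff a k l m" for k l m
  proof -
    have "D (frame k) (frame l) q - D (frame l) (frame k) q = lie_bracket (frame k) (frame l) q"
      using D U q vfield_frame unfolding levi_civita_def torsion_free_def by blast
    then show ?thesis
      unfolding G_def kt_metric_diff_left[OF a, symmetric] by (simp add: lie_bracket_frame[OF a])
  qed
  \<comment> \<open>Koszul's cyclic combination: three instances each of skewness and of vanishing
    torsion determine \<open>G k l m\<close> linearly.\<close>
  have "2 * G k l m = bracket_coeff a k l m - bracket_coeff a l m k + bracket_coeff a m k l"
    using skew[of k l m] skew[of l m k] skew[of m k l] tor[of k l m] tor[of l m k] tor[of m k l]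
    by linarith
  then show ?thesis by (simp add: G_def christoffel_def)
qed

text \<open>Metric compatibility for the product of \<open>V\<close> with e_m shifts the covariant
  derivative from \<open>V\<close> to e_m, where it is known. This avoids expanding \<open>V\<close>
  in the frame by the Leibniz rule.\<close>

lemma levi_civita_along_frame:
  assumes a: "a \<noteq> 0" and D: "levi_civita (kt_metric a) D" and U: "kt_open U" and q: "q \<in> lift U"
    and V: "vfield U V"
  shows "kt_metric a q (D (frame k) V q) (frame m q)
    = frechet_derivative (\<lambda>r. kt_metric a r (V r) (frame m r)) (at q) (frame k q)
      - (\<Sum>l\<in>UNIV. coframe l q (V q) * christoffel a k m l)"
proof -
  have "frechet_derivative (\<lambda>r. kt_metric a r (V r) (frame m r)) (at q) (frame k q)
      = kt_metric a q (D (frame k) V q) (frame m q) + kt_metric a q (V q) (D (frame k) (frame m) q)"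
    using D U q V vfield_frame unfolding levi_civita_def preserves_metric_def by blast
  moreover have "kt_metric a q (V q) (D (frame k) (frame m) q)
      = (\<Sum>l\<in>UNIV. coframe l q (V q) * christoffel a k m l)"
    unfolding kt_metric_frame_left[OF a, of q "V q"]
    by (simp add: kt_metric_commute[OF a, of q "frame _ q"] levi_civita_frame[OF a D U q])
  ultimately show ?thesis by simp
qed

section \<open>The canonical connection along the frame\<close>

lemma vfield_component_derivative:
  assumes "vfield U V" "q \<in> lift U"
  shows "((\<lambda>r. V r $ i) has_derivative (\<lambda>h. frechet_derivative V (at q) h $ i)) (at q)"
proof -
  have "V differentiable at q"
    using assms smooth_on_differentiable unfolding vfield_def by blast
  then have "(V has_derivative frechet_derivative V (at q)) (at q)"
    by (rule frechet_derivative_works[THEN iffD1])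
  then show ?thesis
    by (rule bounded_linear.has_derivative[OF bounded_linear_vec_nth])
qed

text \<open>Components 1 and 3 suffice later, because they determine a (1,0)-vector.\<close>

lemma canonical_conn_along_frame:
  assumes a: "a \<noteq> 0" and D: "levi_civita (kt_metric a) D" and U: "kt_open U" and q: "q \<in> lift U"
    and V: "vfield U V" and JV: "vfield U (\<lambda>r. kt_J a r (V r))"
  shows "canonical_conn (kt_J a) D (frame k) V q $ 1 = frechet_derivative V (at q) (frame k q) $ 1
      + (if k = 3 then V q $ 3 / 4 else if k = 4 then - (a\<^sup>2 / 4) * coframe 4 q (V q) else 0)"
    and "canonical_conn (kt_J a) D (frame k) V q $ 3 = frechet_derivative V (at q) (frame k q) $ 3
      + (if k = 2 then - (a\<^sup>2 / 2) * coframe 4 q (V q) else if k = 3 then - (a / 4) * V q $ 1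
         else if k = 4 then - (a\<^sup>2 / 4) * V q $ 2 else 0)"
proof -
  define F where "F = frechet_derivative V (at q) (frame k q)"
  note der = vfield_component_derivative[OF V q]
  have d: "frechet_derivative (\<lambda>r. V r $ i) (at q) (frame k q) = F $ i" for i
    using frechet_derivative_at[OF der[of i]] by (metis F_def)
  have d3: "frechet_derivative (\<lambda>r. V r $ 3 / a) (at q) (frame k q) = F $ 3 / a"
    using frechet_derivative_at[OF bounded_linear.has_derivative[OF bounded_linear_divide[of a] der[of 3]]]
    unfolding F_def by metis
  note LC = levi_civita_along_frame[OF a D U q V, of k] levi_civita_along_frame[OF a D U q JV, of k]
  note comps = kt_metric_coframe[OF a] coframe_simps frame_nth kt_J_nth sum_4
  \<comment> \<open>Testing \<open>V\<close> against e_1, e_3 and \<open>J V\<close> against e_2,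
    e_4 involves the same functions \<open>V $ 1\<close> and \<open>V $ 3\<close> up to constant
    factors, so each pair of facts shares its derivative term.\<close>
  have 1: "D (frame k) V q $ 1 = F $ 1 - (\<Sum>l\<in>UNIV. coframe l q (V q) * christoffel a k 1 l)"
    using LC(1)[of 1] by (simp add: comps d)
  have 2: "D (frame k) (\<lambda>r. kt_J a r (V r)) q $ 2
      = F $ 1 - (\<Sum>l\<in>UNIV. coframe l q (kt_J a q (V q)) * christoffel a k 2 l)"
    using LC(2)[of 2] by (simp add: comps d)
  have 3: "D (frame k) V q $ 3 = F $ 3 - a * (\<Sum>l\<in>UNIV. coframe l q (V q) * christoffel a k 3 l)"
    using LC(1)[of 3] a by (simp add: comps d3 field_simps)
  have 4: "a * coframe 4 q (D (frame k) (\<lambda>r. kt_J a r (V r)) q)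
      = F $ 3 - (\<Sum>l\<in>UNIV. coframe l q (kt_J a q (V q)) * christoffel a k 4 l)"
    using LC(2)[of 4] a by (simp add: comps d field_simps)
  have S1: "(\<Sum>l\<in>UNIV. coframe l q (V q) * christoffel a k 1 l) = 0"
    using exhaust_4[of k] by (auto simp: sum_4 christoffel_def bracket_coeff_def)
  have S2: "(\<Sum>l\<in>UNIV. coframe l q (kt_J a q (V q)) * christoffel a k 2 l)
      = (if k = 3 then - V q $ 3 / 2 else if k = 4 then a\<^sup>2 / 2 * coframe 4 q (V q) else 0)"
    using exhaust_4[of k] a
    by (auto simp: sum_4 christoffel_def bracket_coeff_def coframe_kt_J power2_eq_square)
  have S3: "a * (\<Sum>l\<in>UNIV. coframe l q (V q) * christoffel a k 3 l)
      = (if k = 2 then a\<^sup>2 / 2 * coframe 4 q (V q)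
         else if k = 4 then a\<^sup>2 / 2 * V q $ 2 else 0)"
    using exhaust_4[of k]
    by (auto simp: sum_4 christoffel_def bracket_coeff_def coframe_simps(1-3) power2_eq_square)
  have S4: "(\<Sum>l\<in>UNIV. coframe l q (kt_J a q (V q)) * christoffel a k 4 l)
      = (if k = 2 then a\<^sup>2 / 2 * coframe 4 q (V q) else if k = 3 then a / 2 * V q $ 1 else 0)"
    using exhaust_4[of k] a
    by (auto simp: sum_4 christoffel_def bracket_coeff_def coframe_kt_J power2_eq_square)
  \<comment> \<open>Since component 1 of \<open>J w\<close> is minus component 2 of
    \<open>w\<close>, the difference in the canonical connection becomes an average.\<close>
  have "canonical_conn (kt_J a) D (frame k) V q $ 1
      = (D (frame k) V q $ 1 + D (frame k) (\<lambda>r. kt_J a r (V r)) q $ 2) / 2"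
    by (simp add: canonical_conn_def kt_J_nth)
  then show "canonical_conn (kt_J a) D (frame k) V q $ 1 = frechet_derivative V (at q) (frame k q) $ 1
      + (if k = 3 then V q $ 3 / 4 else if k = 4 then - (a\<^sup>2 / 4) * coframe 4 q (V q) else 0)"
    unfolding 1 2 S1 S2 F_def by auto
  have "canonical_conn (kt_J a) D (frame k) V q $ 3
      = (D (frame k) V q $ 3 + a * coframe 4 q (D (frame k) (\<lambda>r. kt_J a r (V r)) q)) / 2"
    by (simp add: canonical_conn_def kt_J_nth)
  then show "canonical_conn (kt_J a) D (frame k) V q $ 3 = frechet_derivative V (at q) (frame k q) $ 3
      + (if k = 2 then - (a\<^sup>2 / 2) * coframe 4 q (V q) else if k = 3 then - (a / 4) * V q $ 1
         else if k = 4 then - (a\<^sup>2 / 4) * V q $ 2 else 0)"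
    unfolding 3 4 S3 S4 F_def by auto
qed

section \<open>(1,0)-vectors and the complexified connection\<close>

lemma cplx_vec_simps [simp]:
  "Re_vec (cplx_vec u w) = u" "Im_vec (cplx_vec u w) = w"
  "cplx_vec u w $ i = Complex (u $ i) (w $ i)" "Re_vec v $ i = Re (v $ i)" "Im_vec v $ i = Im (v $ i)"
  by (simp_all add: Re_vec_def Im_vec_def cplx_vec_def vec_eq_iff)

text \<open>Real and imaginary parts of \<open>J v = i v\<close>. The last two equations say that
  \<open>v $ 1\<close> and \<open>v $ 3\<close> are the coordinates of \<open>v\<close> in the basis
  e_1 - i e_2, e_3 - (i/a) e_4.\<close>

lemma T10_kt_J:
  assumes a: "a \<noteq> 0" and v: "v \<in> T10 (kt_J a) q"
  shows "kt_J a q (Re_vec v) = - Im_vec v" and "kt_J a q (Im_vec v) = Re_vec v"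
    and "v $ 2 = - \<i> * v $ 1" and "v $ 4 - q $ 2 * v $ 3 = - \<i> * v $ 3 / a"
proof -
  have eq: "cplx_vec (kt_J a q (Re_vec v)) (kt_J a q (Im_vec v)) = \<i> *s v"
    using v by (simp add: T10_def cplx_endo_def)
  have "Re_vec (\<i> *s v) = - Im_vec v" "Im_vec (\<i> *s v) = Re_vec v"
    by (simp_all add: vec_eq_iff)
  with eq show J: "kt_J a q (Re_vec v) = - Im_vec v" "kt_J a q (Im_vec v) = Re_vec v"
    by (metis cplx_vec_simps(1), metis cplx_vec_simps(2))
  have "- Re (v $ 2) = - Im (v $ 1)" "- Im (v $ 2) = Re (v $ 1)"
    using arg_cong[OF J(1), of "\<lambda>w. w $ 1"] arg_cong[OF J(2), of "\<lambda>w. w $ 1"]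
    by (simp_all add: kt_J_nth)
  then show "v $ 2 = - \<i> * v $ 1" by (simp add: complex_eq_iff)
  have "a * (Re (v $ 4) - q $ 2 * Re (v $ 3)) = Im (v $ 3)"
    "a * (Im (v $ 4) - q $ 2 * Im (v $ 3)) = - Re (v $ 3)"
    using arg_cong[OF J(1), of "\<lambda>w. w $ 3"] arg_cong[OF J(2), of "\<lambda>w. w $ 3"]
    by (simp_all add: kt_J_nth coframe_simps)
  then show "v $ 4 - q $ 2 * v $ 3 = - \<i> * v $ 3 / a"
    using a by (simp add: complex_eq_iff field_simps)
qed

text \<open>That basis is orthogonal for the Hermitian form, with squared lengths 2 and 2/a.\<close>

lemma kt_metric_T10:
  assumes a: "a \<noteq> 0" and v: "v \<in> T10 (kt_J a) q" and w: "w \<in> T10 (kt_J a) q"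
  shows "cplx_bilinear (kt_metric a q) v (cnj_vec w)
    = 2 * v $ 1 * cnj (w $ 1) + 2 / of_real a * v $ 3 * cnj (w $ 3)"
proof -
  have c4: "coframe 4 q (Re_vec u) = Im (u $ 3) / a" "coframe 4 q (Im_vec u) = - Re (u $ 3) / a"
    and c2: "Re (u $ 2) = Im (u $ 1)" "Im (u $ 2) = - Re (u $ 1)"
    if "u \<in> T10 (kt_J a) q" for u
    using T10_kt_J(3,4)[OF a that] by (simp_all add: coframe_simps complex_eq_iff)
  have "Re_vec (cnj_vec w) = Re_vec w" "Im_vec (cnj_vec w) = - Im_vec w"
    by (simp_all add: cnj_vec_def vec_eq_iff)
  moreover have "coframe 4 q (- u) = - coframe 4 q u" for u by (simp add: coframe_simps)
  ultimately show ?thesis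
    using a
    by (simp add: cplx_bilinear_def kt_metric_coframe c4[OF v] c4[OF w] c2[OF v] c2[OF w]
        complex_eq_iff field_simps)
qed

lemma cvfield_component_derivative:
  assumes "cvfield U Z" "q \<in> lift U"
  shows "((\<lambda>r. Z r $ i) has_derivative (\<lambda>h. Complex (frechet_derivative (Re_vec \<circ> Z) (at q) h $ i)
    (frechet_derivative (Im_vec \<circ> Z) (at q) h $ i))) (at q)"
proof -
  have R: "((\<lambda>r. (Re_vec \<circ> Z) r $ i) has_derivative
      (\<lambda>h. frechet_derivative (Re_vec \<circ> Z) (at q) h $ i)) (at q)"
    and I: "((\<lambda>r. (Im_vec \<circ> Z) r $ i) has_derivative
      (\<lambda>h. frechet_derivative (Im_vec \<circ> Z) (at q) h $ i)) (at q)"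
    using assms vfield_component_derivative unfolding cvfield_def by blast+
  show ?thesis
    using has_derivative_add[OF has_derivative_of_real[OF R]
        has_derivative_mult_right[OF has_derivative_of_real[OF I], of \<i>]]
    by (simp add: Complex_eq complex_eq[symmetric])
qed

definition cplx_frame :: "4 \<Rightarrow> real^4 \<Rightarrow> complex^4" where
  "cplx_frame k q = cplx_vec (frame k q) 0"

lemma Re_Im_cplx_frame: "Re_vec \<circ> cplx_frame k = frame k" "Im_vec \<circ> cplx_frame k = (\<lambda>q. 0)"
  by (simp_all add: fun_eq_iff cplx_frame_def)

lemma cvfield_cplx_frame: "cvfield U (cplx_frame k)"
  by (simp add: cvfield_def Re_Im_cplx_frame vfield_frame vfield_zero)

text \<open>Disposes of the terms of \<open>cplx_conn\<close> that differentiate along the zero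
  imaginary part of a real frame field.\<close>

lemma connection_zero_left:
  assumes "is_connection D" "kt_open U" "vfield U V" "q \<in> lift U"
  shows "D (\<lambda>r. 0) V q = 0"
proof -
  note add = assms(1)[unfolded is_connection_def, THEN conjunct2, THEN conjunct2, THEN conjunct1]
  have "D (\<lambda>r. 0 + 0) V q = D (\<lambda>r. 0) V q + D (\<lambda>r. 0) V q"
    by (rule add[rule_format]) (use assms vfield_zero in simp_all)
  then show ?thesis by simp
qed

text \<open>This is the connection matrix in the basis e_1 - i e_2, e_3 - (i/a) e_4. Its only
  nonzero diagonal entry is \<open>\<i> * a / 2\<close>, along e_2.\<close>

lemma cplx_conn_canonical_frame:
  assumes a: "a \<noteq> 0" and D: "levi_civita (kt_metric a) D" and U: "kt_open U" and q: "q \<in> lift U"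
    and Z: "cvfield U Z" and T: "\<And>r. r \<in> lift U \<Longrightarrow> Z r \<in> T10 (kt_J a) r"
  shows "cplx_conn (canonical_conn (kt_J a) D) (cplx_frame k) Z q $ 1
      = frechet_derivative (\<lambda>r. Z r $ 1) (at q) (frame k q)
      + (if k = 3 then 1 / 4 else if k = 4 then \<i> * a / 4 else 0) * Z q $ 3"
    and "cplx_conn (canonical_conn (kt_J a) D) (cplx_frame k) Z q $ 3
      = frechet_derivative (\<lambda>r. Z r $ 3) (at q) (frame k q)
      + (if k = 2 then \<i> * a / 2 else 0) * Z q $ 3
      + (if k = 3 then - of_real a / 4 else if k = 4 then \<i> * (of_real a)\<^sup>2 / 4 else 0) * Z q $ 1"
proof -
  define Y where "Y = Re_vec \<circ> Z"
  define W where "W = Im_vec \<circ> Z"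
  have Y: "vfield U Y" and W: "vfield U W"
    using Z by (auto simp: cvfield_def Y_def W_def)
  have nth: "Y r $ i = Re (Z r $ i)" "W r $ i = Im (Z r $ i)" for r i
    by (simp_all add: Y_def W_def)
  \<comment> \<open>Over \<open>U\<close> the field \<open>J Y\<close> is \<open>- W\<close> and
    \<open>J W\<close> is \<open>Y\<close>, so both are again vector fields.\<close>
  have JY: "vfield U (\<lambda>r. kt_J a r (Y r))"
    by (rule vfield_cong[OF U _ vfield_minus[OF U W]]) (simp add: T10_kt_J(1)[OF a T] Y_def W_def)
  have JW: "vfield U (\<lambda>r. kt_J a r (W r))"
    by (rule vfield_cong[OF U _ Y]) (simp add: T10_kt_J(2)[OF a T] Y_def W_def)
  have conn: "is_connection D" using D by (simp add: levi_civita_def)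
  have J0: "kt_J a q 0 = 0" by (simp add: vec_eq_iff forall_4 kt_J_nth coframe_simps)
  have zero: "canonical_conn (kt_J a) D (\<lambda>r. 0) Y q = 0"
    "canonical_conn (kt_J a) D (\<lambda>r. 0) W q = 0"
    using connection_zero_left[OF conn U _ q] Y W JY JW
    by (simp_all add: canonical_conn_def J0)
  have C: "cplx_conn (canonical_conn (kt_J a) D) (cplx_frame k) Z q
      = cplx_vec (canonical_conn (kt_J a) D (frame k) Y q)
          (canonical_conn (kt_J a) D (frame k) W q)"
    by (simp add: cplx_conn_def Re_Im_cplx_frame zero Y_def[symmetric] W_def[symmetric])
  have der: "frechet_derivative (\<lambda>r. Z r $ i) (at q) (frame k q)
      = Complex (frechet_derivative Y (at q) (frame k q) $ i)
          (frechet_derivative W (at q) (frame k q) $ i)" for i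
    using frechet_derivative_at[OF cvfield_component_derivative[OF Z q, of i], symmetric] by (simp add: Y_def W_def)
  have c4: "coframe 4 q (Y q) = Im (Z q $ 3) / a"
    "coframe 4 q (W q) = - Re (Z q $ 3) / a"
    and c2: "Re (Z q $ 2) = Im (Z q $ 1)" "Im (Z q $ 2) = - Re (Z q $ 1)"
    using T10_kt_J(3,4)[OF a T[OF q]] by (simp_all add: coframe_simps nth complex_eq_iff)
  show "cplx_conn (canonical_conn (kt_J a) D) (cplx_frame k) Z q $ 1
      = frechet_derivative (\<lambda>r. Z r $ 1) (at q) (frame k q)
      + (if k = 3 then 1 / 4 else if k = 4 then \<i> * a / 4 else 0) * Z q $ 3"
    using a unfolding C der
    by (auto simp: canonical_conn_along_frame(1)[OF a D U q Y JY]
        canonical_conn_along_frame(1)[OF a D U q W JW] nth c4 complex_eq_iff power2_eq_square)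
  show "cplx_conn (canonical_conn (kt_J a) D) (cplx_frame k) Z q $ 3
      = frechet_derivative (\<lambda>r. Z r $ 3) (at q) (frame k q)
      + (if k = 2 then \<i> * a / 2 else 0) * Z q $ 3
      + (if k = 3 then - of_real a / 4 else if k = 4 then \<i> * (of_real a)\<^sup>2 / 4 else 0) * Z q $ 1"
    using a unfolding C der
    by (auto simp: canonical_conn_along_frame(2)[OF a D U q Y JY]
        canonical_conn_along_frame(2)[OF a D U q W JW] nth c4 c2 complex_eq_iff power2_eq_square)
qed

section \<open>The trace of the connection matrix\<close>

lemma dir_deriv_linear:
  assumes "f differentiable at q"
  shows "Vector_Spaces.linear (*s) (*) (dir_deriv f q)"
proof -
  have l: "linear (frechet_derivative f (at q))"
    using assms by (rule linear_frechet_derivative)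
  have Re_scale: "Re_vec (c *s v) = Re c *\<^sub>R Re_vec v - Im c *\<^sub>R Im_vec v"
    and Im_scale: "Im_vec (c *s v) = Re c *\<^sub>R Im_vec v + Im c *\<^sub>R Re_vec v"
    and add: "Re_vec (v + w) = Re_vec v + Re_vec w" "Im_vec (v + w) = Im_vec v + Im_vec w" for c v w
    by (simp_all add: vec_eq_iff)
  show ?thesis
    unfolding Vector_Spaces.linear_iff
    by (auto simp: vec.vector_space_axioms vector_space_over_itself.vector_space_axioms dir_deriv_def
        Re_scale Im_scale add linear_add[OF l] linear_diff[OF l] linear_cmul[OF l]
        complex_eq_iff algebra_simps)
qed

text \<open>The frame is a complex basis of the complexified tangent space. Identities checked along
  the real frame fields thereby extend to all complex vectors.\<close>

lemma linear_eq_on_cplx_frame: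
  assumes "Vector_Spaces.linear (*s) (*) f" "Vector_Spaces.linear (*s) (*) g"
    and "\<And>k. f (cplx_frame k q) = g (cplx_frame k q)"
  shows "f w = (g w :: complex)"
proof -
  define c where "c k = (if k = 4 then w $ 4 - of_real (q $ 2) * w $ 3 else w $ k)" for k :: 4
  have w: "w = c 1 *s cplx_frame 1 q + (c 2 *s cplx_frame 2 q
      + (c 3 *s cplx_frame 3 q + c 4 *s cplx_frame 4 q))"
    by (simp add: vec_eq_iff forall_4 c_def cplx_frame_def frame_nth complex_eq_iff)
  have "h w = c 1 * h (cplx_frame 1 q) + (c 2 * h (cplx_frame 2 q)
      + (c 3 * h (cplx_frame 3 q) + c 4 * h (cplx_frame 4 q)))"
    if "Vector_Spaces.linear (*s) (*) h" for h :: "complex^4 \<Rightarrow> complex"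
    using that by (subst w) (simp add: Vector_Spaces.linear_iff)
  from this[OF assms(1)] this[OF assms(2)] show ?thesis by (simp add: assms(3))
qed

text \<open>For a frame of (1,0)-vectors this is det G, with G the matrix expressing
  \<open>z\<close> in the basis e_1 - i e_2, e_3 - (i/a) e_4.\<close>

definition frame_det :: "(2 \<Rightarrow> real^4 \<Rightarrow> complex^4) \<Rightarrow> real^4 \<Rightarrow> complex" where
  "frame_det z q = z 1 q $ 1 * z 2 q $ 3 - z 2 q $ 1 * z 1 q $ 3"

text \<open>The determinant of the Gram matrix is \<open>4 / a * \<bar>frame_det\<bar>\<^sup>2\<close>.\<close>

lemma frame_det_nonzero:
  assumes a: "a \<noteq> 0" and z: "unitary_frame (kt_metric a) (kt_J a) U z" and q: "q \<in> lift U"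
  shows "frame_det z q \<noteq> 0"
proof
  assume 0: "frame_det z q = 0"
  define h where "h i j = cplx_bilinear (kt_metric a q) (z i q) (cnj_vec (z j q))" for i j
  have T: "z j q \<in> T10 (kt_J a) q" for j using z q unfolding unitary_frame_def by blast
  have h: "h i j = 2 * z i q $ 1 * cnj (z j q $ 1) + 2 / of_real a * z i q $ 3 * cnj (z j q $ 3)" for i j
    unfolding h_def by (rule kt_metric_T10[OF a T T])
  have "h 1 1 * h 2 2 - h 1 2 * h 2 1 = 4 / of_real a * frame_det z q * cnj (frame_det z q)"
    unfolding h frame_det_def by (simp add: algebra_simps)
  moreover have "h i j = (if i = j then 1 else 0)" for i j
    using z q unfolding unitary_frame_def h_def by blast
  ultimately show False using 0 by simp
qed

lemma frame_det_differentiable: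
  assumes z: "unitary_frame g J U z" and q: "q \<in> lift U"
  shows "frame_det z differentiable at q"
    and "frechet_derivative (frame_det z) (at q) h
      = frechet_derivative (\<lambda>r. z 1 r $ 1) (at q) h * z 2 q $ 3
      + z 1 q $ 1 * frechet_derivative (\<lambda>r. z 2 r $ 3) (at q) h
      - (frechet_derivative (\<lambda>r. z 2 r $ 1) (at q) h * z 1 q $ 3
      + z 2 q $ 1 * frechet_derivative (\<lambda>r. z 1 r $ 3) (at q) h)"
proof -
  have "(\<lambda>r. z j r $ i) differentiable at q" for i j
    using cvfield_component_derivative[OF _ q] z
    unfolding unitary_frame_def differentiable_def by blast
  then have d: "((\<lambda>r. z j r $ i) has_derivative frechet_derivative (\<lambda>r. z j r $ i) (at q)) (at q)" for i j
    by (simp add: frechet_derivative_works[symmetric])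
  have "(frame_det z has_derivative (\<lambda>h. z 1 q $ 1 * frechet_derivative (\<lambda>r. z 2 r $ 3) (at q) h
      + frechet_derivative (\<lambda>r. z 1 r $ 1) (at q) h * z 2 q $ 3
      - (z 2 q $ 1 * frechet_derivative (\<lambda>r. z 1 r $ 3) (at q) h
      + frechet_derivative (\<lambda>r. z 2 r $ 1) (at q) h * z 1 q $ 3))) (at q)"
    unfolding frame_det_def[abs_def] by (intro has_derivative_diff has_derivative_mult d)
  note der = this
  show "frame_det z differentiable at q" using der by (rule differentiableI)
  show "frechet_derivative (frame_det z) (at q) h
      = frechet_derivative (\<lambda>r. z 1 r $ 1) (at q) h * z 2 q $ 3
      + z 1 q $ 1 * frechet_derivative (\<lambda>r. z 2 r $ 3) (at q) h
      - (frechet_derivative (\<lambda>r. z 2 r $ 1) (at q) h * z 1 q $ 3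
      + z 2 q $ 1 * frechet_derivative (\<lambda>r. z 1 r $ 3) (at q) h)"
    unfolding frechet_derivative_at[OF der, symmetric] by simp
qed

text \<open>Differentiate the determinant row by row and substitute the connection equations for the
  derivatives of the entries; the \<theta>-terms combine to the trace times the determinant.\<close>

lemma trace_connection_form_frame:
  assumes a: "a \<noteq> 0" and D: "levi_civita (kt_metric a) D" and U: "kt_open U" and q: "q \<in> lift U"
    and z: "unitary_frame (kt_metric a) (kt_J a) U z"
    and \<theta>: "connection_forms (canonical_conn (kt_J a) D) U z \<theta>"
  shows "(\<theta> 1 1 q (cplx_frame k q) + \<theta> 2 2 q (cplx_frame k q)) * frame_det z q
    = frechet_derivative (frame_det z) (at q) (frame k q)
      + (if k = 2 then \<i> * a / 2 else 0) * frame_det z q"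
proof -
  have Z: "cvfield U (z j)" and T: "r \<in> lift U \<Longrightarrow> z j r \<in> T10 (kt_J a) r" for j r
    using z unfolding unitary_frame_def by blast+
  note nabla = cplx_conn_canonical_frame[OF a D U q Z T, where k = k]
  have conn: "cplx_conn (canonical_conn (kt_J a) D) (cplx_frame k) (z j) q $ i
      = \<theta> 1 j q (cplx_frame k q) * z 1 q $ i + \<theta> 2 j q (cplx_frame k q) * z 2 q $ i" for i j
    using \<theta> q cvfield_cplx_frame unfolding connection_forms_def by (simp add: sum_2)
  \<comment> \<open>The off-diagonal coefficients \<open>p\<close> and \<open>t\<close> multiply
    determinants with two equal rows and cancel; only the diagonal \<open>s\<close>
    survives.\<close>
  define p where "p = (if k = 3 then 1 / 4 else if k = 4 then \<i> * a / 4 else 0)"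
  define s where "s = (if k = 2 then \<i> * a / 2 else 0)"
  define t where "t = (if k = 3 then - of_real a / 4 else if k = 4 then \<i> * (of_real a)\<^sup>2 / 4 else 0)"
  have 1: "frechet_derivative (\<lambda>r. z j r $ 1) (at q) (frame k q)
      = \<theta> 1 j q (cplx_frame k q) * z 1 q $ 1 + \<theta> 2 j q (cplx_frame k q) * z 2 q $ 1 - p * z j q $ 3" for j
    using nabla(1)[of j] unfolding conn p_def by (simp add: algebra_simps)
  have 3: "frechet_derivative (\<lambda>r. z j r $ 3) (at q) (frame k q)
      = \<theta> 1 j q (cplx_frame k q) * z 1 q $ 3 + \<theta> 2 j q (cplx_frame k q) * z 2 q $ 3
        - s * z j q $ 3 - t * z j q $ 1" for j
    using nabla(2)[of j] unfolding conn s_def t_def by (simp add: algebra_simps)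
  show ?thesis
    unfolding frame_det_differentiable(2)[OF z q] 1 3 s_def[symmetric] frame_det_def
    by (simp add: algebra_simps)
qed

text \<open>As \<open>w $ 2\<close> is dx(w), this is the formula tr \<theta> = d log det G + (i a /
  2) dx with the denominator cleared.\<close>

lemma trace_connection_form:
  assumes a: "a \<noteq> 0" and D: "levi_civita (kt_metric a) D" and U: "kt_open U" and q: "q \<in> lift U"
    and z: "unitary_frame (kt_metric a) (kt_J a) U z"
    and \<theta>: "connection_forms (canonical_conn (kt_J a) D) U z \<theta>"
  shows "(\<theta> 1 1 q w + \<theta> 2 2 q w) * frame_det z q
    = dir_deriv (frame_det z) q w + \<i> * a / 2 * w $ 2 * frame_det z q"
proof (rule linear_eq_on_cplx_frame[where q = q])
  have "Vector_Spaces.linear (*s) (*) (\<theta> i j q)" for i j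
    using \<theta> q unfolding connection_forms_def form1_def by blast
  then show "Vector_Spaces.linear (*s) (*) (\<lambda>w. (\<theta> 1 1 q w + \<theta> 2 2 q w) * frame_det z q)"
    by (simp add: Vector_Spaces.linear_iff algebra_simps)
  show "Vector_Spaces.linear (*s) (*)
      (\<lambda>w. dir_deriv (frame_det z) q w + \<i> * a / 2 * w $ 2 * frame_det z q)"
    using dir_deriv_linear[OF frame_det_differentiable(1)[OF z q]]
    by (simp add: Vector_Spaces.linear_iff algebra_simps)
next
  have f0: "frechet_derivative (frame_det z) (at q) 0 = 0"
    using frame_det_differentiable(1)[OF z q] linear_frechet_derivative linear_0 by blast
  fix k
  show "(\<theta> 1 1 q (cplx_frame k q) + \<theta> 2 2 q (cplx_frame k q)) * frame_det z q
    = dir_deriv (frame_det z) q (cplx_frame k q) + \<i> * a / 2 * cplx_frame k q $ 2 * frame_det z q"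
    unfolding trace_connection_form_frame[OF a D U q z \<theta>]
    by (simp add: dir_deriv_def cplx_frame_def f0 frame_nth complex_eq_iff)
qed

text \<open>The last hypothesis says \<open>\<tau> = d log f + c\<close>; multiplying by \<open>f\<close> avoids a branch of the logarithm.\<close>

lemma ext_deriv_log_derivative:
  assumes S: "open S" "q \<in> S"
    and f: "\<And>r. r \<in> S \<Longrightarrow> f differentiable at r" "\<And>r. r \<in> S \<Longrightarrow> f r \<noteq> 0"
    and \<tau>: "\<And>v. (\<lambda>r. \<tau> r v) differentiable at q"
    and eq: "\<And>r v. r \<in> S \<Longrightarrow> \<tau> r v * f r = dir_deriv f r v + c v * f r"
  shows "ext_deriv \<tau> q v w = 0"
proof -
  define E where "E r = frechet_derivative f (at r)" for r
  define A where "A u = frechet_derivative (\<lambda>r. E r u) (at q)" for u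
  have fE: "(f has_derivative E r) (at r)" if "r \<in> S" for r
    unfolding E_def using f(1)[OF that] by (rule frechet_derivative_works[THEN iffD1])
  have E_eq: "E r u = (\<tau> r (cplx_vec u 0) - c (cplx_vec u 0)) * f r" if "r \<in> S" for r u
    using eq[OF that, of "cplx_vec u 0"] linear_0[OF has_derivative_linear[OF fE[OF that]]]
    by (simp add: dir_deriv_def E_def algebra_simps)
  \<comment> \<open>Second differentiability of \<open>f\<close> at \<open>q\<close> is read off
    from \<open>eq\<close>, which writes \<open>E\<close> near \<open>q\<close> as a product of
    functions differentiable there.\<close>
  have EA: "((\<lambda>r. E r u) has_derivative A u) (at q)" for u
  proof -
    have "(\<lambda>r. (\<tau> r (cplx_vec u 0) - c (cplx_vec u 0)) * f r) differentiable at q"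
      using \<tau> f(1)[OF S(2)] by (intro differentiable_mult differentiable_diff differentiable_const)
    then obtain B where
      "((\<lambda>r. (\<tau> r (cplx_vec u 0) - c (cplx_vec u 0)) * f r) has_derivative B) (at q)"
      by (auto simp: differentiable_def)
    then have "((\<lambda>r. E r u) has_derivative B) (at q)"
      by (rule has_derivative_transform_within_open[OF _ S]) (simp add: E_eq)
    then show ?thesis unfolding A_def using frechet_derivative_at by metis
  qed
  have sym: "A u u' = A u' u" for u u'
    using second_derivative_symmetric[OF S fE EA EA] .
  have nz: "f q \<noteq> 0" using f(2) S(2) by blast
  have "frechet_derivative (\<lambda>r. \<tau> r v) (at q) h = (A (Re_vec v) h + \<i> * A (Im_vec v) h) / f q
      - (E q (Re_vec v) + \<i> * E q (Im_vec v)) * E q h / (f q)\<^sup>2" for v h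
  proof -
    have "((\<lambda>r. (E r (Re_vec v) + \<i> * E r (Im_vec v)) / f r + c v) has_derivative
       (\<lambda>h. (A (Re_vec v) h + \<i> * A (Im_vec v) h) / f q
        - (E q (Re_vec v) + \<i> * E q (Im_vec v)) * E q h / (f q)\<^sup>2)) (at q)"
      using nz
      by (auto intro!: derivative_eq_intros EA fE[OF S(2)] simp: fun_eq_iff power2_eq_square field_simps)
    then have "((\<lambda>r. \<tau> r v) has_derivative
       (\<lambda>h. (A (Re_vec v) h + \<i> * A (Im_vec v) h) / f q
        - (E q (Re_vec v) + \<i> * E q (Im_vec v)) * E q h / (f q)\<^sup>2)) (at q)"
    proof (rule has_derivative_transform_within_open[OF _ S])
      fix r assume r: "r \<in> S"
      show "(E r (Re_vec v) + \<i> * E r (Im_vec v)) / f r + c v = \<tau> r v"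
        using eq[OF r, of v] f(2)[OF r] by (simp add: E_def dir_deriv_def field_simps)
    qed
    note der = this
    show ?thesis unfolding frechet_derivative_at[OF der, symmetric] by (rule refl)
  qed
  note der = this
  \<comment> \<open>Antisymmetrizing in \<open>v\<close> and \<open>w\<close> kills the second
    derivatives by \<open>sym\<close> and the quotient terms because they are products of first
    derivatives; the form \<open>c\<close> has constant coefficients and leaves no trace.\<close>
  show ?thesis
    unfolding ext_deriv_def dir_deriv_def der sym[of "Re_vec w" "Re_vec v"]
      sym[of "Re_vec w" "Im_vec v"] sym[of "Im_vec w" "Re_vec v"] sym[of "Im_vec w" "Im_vec v"]
    by (simp add: algebra_simps add_divide_distrib diff_divide_distrib)
qed

section \<open>The trace of the curvature, Ricci form and scalar curvature\<close>

lemma trace_curvature_form: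
  assumes a: "a \<noteq> 0" and D: "levi_civita (kt_metric a) D" and U: "kt_open U" and q: "q \<in> lift U"
    and z: "unitary_frame (kt_metric a) (kt_J a) U z"
    and \<theta>: "connection_forms (canonical_conn (kt_J a) D) U z \<theta>"
  shows "curvature_form \<theta> 1 1 q v w + curvature_form \<theta> 2 2 q v w = 0"
proof -
  define \<tau> where "\<tau> r v = \<theta> 1 1 r v + \<theta> 2 2 r v" for r v
  have d\<theta>: "(\<lambda>r. \<theta> i j r v) differentiable at q" for i j v
    using \<theta> q smooth_on_differentiable unfolding connection_forms_def form1_def by blast
  have "ext_deriv \<tau> q v w = 0"
  \<comment> \<open>Here \<open>f\<close> is the frame determinant, nonzero by unitarity, and
    \<open>c\<close> is (i a / 2) dx.\<close>
  proof (rule ext_deriv_log_derivative[OF kt_open_lift[OF U] q])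
    show "frame_det z differentiable at r" if "r \<in> lift U" for r
      using frame_det_differentiable(1)[OF z that] .
    show "frame_det z r \<noteq> 0" if "r \<in> lift U" for r
      using frame_det_nonzero[OF a z that] .
    show "(\<lambda>r. \<tau> r v) differentiable at q" for v
      unfolding \<tau>_def by (intro differentiable_add d\<theta>)
    show "\<tau> r v * frame_det z r = dir_deriv (frame_det z) r v + \<i> * a / 2 * v $ 2 * frame_det z r"
      if "r \<in> lift U" for r v
      unfolding \<tau>_def by (rule trace_connection_form[OF a D U that z \<theta>])
  qed
  moreover have "ext_deriv \<tau> q v w = ext_deriv (\<theta> 1 1) q v w + ext_deriv (\<theta> 2 2) q v w"
  proof -
    have "frechet_derivative (\<lambda>r. \<tau> r v) (at q) h = frechet_derivative (\<lambda>r. \<theta> 1 1 r v) (at q) h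
        + frechet_derivative (\<lambda>r. \<theta> 2 2 r v) (at q) h" for v h
      unfolding \<tau>_def
      using fun_cong[OF frechet_derivative_at[OF has_derivative_add[OF
            frechet_derivative_works[THEN iffD1, OF d\<theta>[of 1 1 v]]
            frechet_derivative_works[THEN iffD1, OF d\<theta>[of 2 2 v]]]], symmetric] .
    then show ?thesis by (simp add: ext_deriv_def dir_deriv_def algebra_simps)
  qed
  \<comment> \<open>The wedge terms cancel: the diagonal ones vanish, and the two mixed ones are
    opposite.\<close>
  ultimately show ?thesis
    by (simp add: curvature_form_def sum_2 wedge_def algebra_simps)
qed

theorem theorem4p6:
  fixes a :: real
    and D :: connection
    and U :: "kt_point set"
    and z :: "2 \<Rightarrow> real^4 \<Rightarrow> complex^4"
    and zd :: "2 \<Rightarrow> cform1"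
    and \<theta> :: "2 \<Rightarrow> 2 \<Rightarrow> cform1"
    and R :: "2 \<Rightarrow> 2 \<Rightarrow> 2 \<Rightarrow> 2 \<Rightarrow> kt_point \<Rightarrow> complex"
  assumes "a > 0"
    and "levi_civita (kt_metric a) D"
    and "kt_open U"
    and "unitary_frame (kt_metric a) (kt_J a) U z"
    and "dual_coframe U z zd"
    and "connection_forms (canonical_conn (kt_J a) D) U z \<theta>"
    and "curvature_coeffs (kt_J a) U zd \<theta> R"
  shows "(\<forall>q\<in>lift U. \<forall>v w. ricci_form zd R q v w = 0) \<and> (\<forall>p\<in>U. scalar_curv R p = 0)"
proof -
  have a: "a \<noteq> 0" using assms(1) by simp
  note trace = trace_curvature_form[OF a assms(2,3) _ assms(4,6)]
  have ricci: "ricci_form zd R q v w = 0" if q: "q \<in> lift U" for q v w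
  proof -
    \<comment> \<open>Contracting the upper index with the first lower one commutes with taking the
      (1,1)-part, so the Ricci form is the (1,1)-part of the curvature trace.\<close>
    have "ricci_form zd R q v w = part11 (kt_J a) (curvature_form \<theta> 1 1) q v w
        + part11 (kt_J a) (curvature_form \<theta> 2 2) q v w"
      using assms(7) q unfolding curvature_coeffs_def
      by (simp add: ricci_form_def ricci_coeff_def sum_2 algebra_simps)
    also have "\<dots> = 0"
      using trace[OF q, of "proj10 (kt_J a) q v" "proj01 (kt_J a) q w"]
        trace[OF q, of "proj01 (kt_J a) q v" "proj10 (kt_J a) q w"]
      by (simp add: part11_def algebra_simps add_eq_0_iff)
    finally show ?thesis .
  qed
  have "scalar_curv R p = 0" if p: "p \<in> U" for p
  proof -
    obtain q where q: "p = kt_proj q"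
      using p assms(3) range_kt_proj unfolding kt_open_def by blast
    then have "q \<in> lift U" using p by simp
    have dual: "zd i q (z j q) = (if i = j then 1 else 0)" "zd i q (cnj_vec (z j q)) = 0" for i j
      using assms(5) \<open>q \<in> lift U\<close> unfolding dual_coframe_def by blast+
    have "cnj_vec (cnj_vec v) = v" for v by (simp add: cnj_vec_def vec_eq_iff)
    \<comment> \<open>Evaluation on a frame vector and a conjugate frame vector extracts a single
      coefficient, so vanishing of the form forces each diagonal Ricci coefficient to
      vanish.\<close>
    then have "(zd k \<and>\<^sub>F cnj_form (zd l)) q (z i q) (cnj_vec (z j q))
        = (if k = i \<and> l = j then 1 else 0)" for i j k l
      by (simp add: wedge_def cnj_form_def dual)
    then have "ricci_form zd R q (z k q) (cnj_vec (z k q)) = ricci_coeff R k k p" for k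
      using exhaust_2[of k] by (auto simp: ricci_form_def q sum_2)
    then show ?thesis
      using ricci[OF \<open>q \<in> lift U\<close>] by (simp add: scalar_curv_def)
  qed
  with ricci show ?thesis by blast
qed

end
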